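(* Let $T\subset\mathbb{R}^2_\ge$ be a (nondegenerate) triangle with rational vertices. If the semigroup $\mathcal{T}=\bigcup_{i=0}^\infty T_i\cap\mathbb{N}^2$ generated by $T$ is affine, then it is Cohen-Macaulay.
   Context: $\mathbb{N}$ denotes the nonnegative integers and $\mathbb{R}_\ge$ the nonnegative reals. A triangle means the full (filled) convex polygon; for $i\in\mathbb{N}$, $T_i=\{iX\mid X\in T\}$. A submonoid of $\mathbb{N}^2$ is affine if it is finitely generated. Fix a field $K$; a semigroup $S$ is called Cohen-Macaulay if the semigroup ring $K[S]$ is a Cohen-Macaulay ring. *)

theory Defs
  imports
    "HOL-Analysis.Analysis"
    "HOL-Algebra.QuotRing"
    "HOL-Algebra.Ring_Divisibility"
    "HOL-Library.Poly_Mapping"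
    "HOL-Library.Product_Plus"
    "HOL-Library.Extended_Nat"
begin

section \<open>Semigroups generated by plane triangles\<close>

text \<open>
  Collinearity is used instead of affine dependence of the set \<open>{A, B, C}\<close>, because the latter would
  allow two of the vertices to coincide.
\<close>

definition rational_triangle :: "(real \<times> real) set \<Rightarrow> bool" where
  "rational_triangle T \<longleftrightarrow>
     (\<exists>A B C. {A, B, C} \<subseteq> \<rat> \<times> \<rat> \<and> \<not> collinear {A, B, C} \<and> T = convex hull {A, B, C})"

definition body_semigroup :: "(real \<times> real) set \<Rightarrow> (nat \<times> nat) set" where
  "body_semigroup T = (\<Union>i::nat. {(m, n). (real m, real n) \<in> (\<lambda>X. real i *\<^sub>R X) ` T})"

definition is_submonoid :: "'a::monoid_add set \<Rightarrow> bool" where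
  "is_submonoid S \<longleftrightarrow> 0 \<in> S \<and> (\<forall>x\<in>S. \<forall>y\<in>S. x + y \<in> S)"

definition affine_semigroup :: "(nat \<times> nat) set \<Rightarrow> bool" where
  "affine_semigroup S \<longleftrightarrow> is_submonoid S \<and> (\<exists>G. finite G \<and> S = is_submonoid hull G)"

text \<open>
  The elements of \<open>K[S]\<close> are the finitely supported functions on the ambient monoid whose support
  lies in \<open>S\<close>; their product is convolution, that is, the ring multiplication of \<^type>\<open>poly_mapping\<close>.
\<close>

definition semigroup_ring :: "'a::comm_monoid_add set \<Rightarrow> ('a \<Rightarrow>\<^sub>0 'k::field) ring" where
  "semigroup_ring S =
     \<lparr>carrier = {p. Poly_Mapping.keys p \<subseteq> S}, mult = (*), one = 1, zero = 0, add = (+)\<rparr>"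


section \<open>Localization\<close>

text \<open>
  The ring of fractions \<open>M\<^sup>-\<^sup>1 R\<close> of a commutative ring \<open>R\<close> at a multiplicatively closed set \<open>M\<close>.  Its
  elements are classes of pairs \<open>(a, s)\<close>, to be read as \<open>a / s\<close>.  In the operations the unions range over all
  representatives; since the result does not depend on them, each union is a single class.
\<close>

definition frac_rel :: "('a, 'b) ring_scheme \<Rightarrow> 'a set \<Rightarrow> (('a \<times> 'a) \<times> ('a \<times> 'a)) set" where
  "frac_rel R M = {((a, s), (b, t)). a \<in> carrier R \<and> s \<in> M \<and> b \<in> carrier R \<and> t \<in> M \<and>
     (\<exists>u\<in>M. u \<otimes>\<^bsub>R\<^esub> (a \<otimes>\<^bsub>R\<^esub> t) = u \<otimes>\<^bsub>R\<^esub> (b \<otimes>\<^bsub>R\<^esub> s))}"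

definition frac_class :: "('a, 'b) ring_scheme \<Rightarrow> 'a set \<Rightarrow> 'a \<Rightarrow> 'a \<Rightarrow> ('a \<times> 'a) set" where
  "frac_class R M a s = frac_rel R M `` {(a, s)}"

definition fraction_ring :: "('a, 'b) ring_scheme \<Rightarrow> 'a set \<Rightarrow> ('a \<times> 'a) set ring" where
  "fraction_ring R M =
     \<lparr>carrier = (carrier R \<times> M) // frac_rel R M,
      mult = (\<lambda>X Y. \<Union>(a, s)\<in>X. \<Union>(b, t)\<in>Y. frac_class R M (a \<otimes>\<^bsub>R\<^esub> b) (s \<otimes>\<^bsub>R\<^esub> t)),
      one = frac_class R M \<one>\<^bsub>R\<^esub> \<one>\<^bsub>R\<^esub>,
      zero = frac_class R M \<zero>\<^bsub>R\<^esub> \<one>\<^bsub>R\<^esub>,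
      add = (\<lambda>X Y. \<Union>(a, s)\<in>X. \<Union>(b, t)\<in>Y.
               frac_class R M (a \<otimes>\<^bsub>R\<^esub> t \<oplus>\<^bsub>R\<^esub> b \<otimes>\<^bsub>R\<^esub> s) (s \<otimes>\<^bsub>R\<^esub> t))\<rparr>"

definition localization :: "('a, 'b) ring_scheme \<Rightarrow> 'a set \<Rightarrow> ('a \<times> 'a) set ring" where
  "localization R P = fraction_ring R (carrier R - P)"


section \<open>Cohen-Macaulay rings\<close>

definition krull_dim :: "('a, 'b) ring_scheme \<Rightarrow> enat" where
  "krull_dim R = (SUP n \<in> {n. \<exists>P :: nat \<Rightarrow> 'a set.
     (\<forall>i\<le>n. primeideal (P i) R) \<and> (\<forall>i<n. P i \<subset> P (Suc i))}. enat n)"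

definition nonzerodivisor :: "('a, 'b) ring_scheme \<Rightarrow> 'a \<Rightarrow> bool" where
  "nonzerodivisor R x \<longleftrightarrow> x \<in> carrier R \<and>
     (\<forall>y\<in>carrier R. x \<otimes>\<^bsub>R\<^esub> y = \<zero>\<^bsub>R\<^esub> \<longrightarrow> y = \<zero>\<^bsub>R\<^esub>)"

definition regular_sequence :: "('a, 'b) ring_scheme \<Rightarrow> 'a list \<Rightarrow> bool" where
  "regular_sequence R xs \<longleftrightarrow> set xs \<subseteq> carrier R \<and>
     (\<forall>i<length xs.
        nonzerodivisor (R Quot (Idl\<^bsub>R\<^esub> (set (take i xs)))) (Idl\<^bsub>R\<^esub> (set (take i xs)) +>\<^bsub>R\<^esub> (xs ! i))) \<and>
     Idl\<^bsub>R\<^esub> (set xs) \<noteq> carrier R"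

definition depth :: "('a, 'b) ring_scheme \<Rightarrow> 'a set \<Rightarrow> enat" where
  "depth R I = (SUP xs \<in> {xs. regular_sequence R xs \<and> set xs \<subseteq> I}. enat (length xs))"

definition cohen_macaulay_local :: "('a, 'b) ring_scheme \<Rightarrow> bool" where
  "cohen_macaulay_local R \<longleftrightarrow> cring R \<and> noetherian_ring R \<and>
     (\<exists>!I. maximalideal I R) \<and> (\<forall>I. maximalideal I R \<longrightarrow> depth R I = krull_dim R)"

definition cohen_macaulay :: "('a, 'b) ring_scheme \<Rightarrow> bool" where
  "cohen_macaulay R \<longleftrightarrow> cring R \<and> noetherian_ring R \<and>
     (\<forall>I. maximalideal I R \<longrightarrow> cohen_macaulay_local (localization R I))"

end

theory Submission
  imports Defs
begin

text \<open>
  Let \<open>S\<close> be the semigroup of a rational triangle \<open>T\<close> and \<open>R = K[S]\<close>.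

  The geometric input is that \<open>S\<close> has no gaps of a certain kind.  The vertices can be named such that \<open>A\<close> and \<open>B\<close>
  are linearly independent and \<open>C\<close> lies in the cone spanned by them; a common multiple \<open>k\<close> of the
  denominators gives points \<open>n1 = k A\<close> and \<open>n2 = k B\<close> of \<open>S\<close> on the two extremal rays.  If \<open>t\<close> is a lattice
  point with \<open>t + n1 \<in> S\<close> and \<open>t + n2 \<in> S\<close>, both points are combinations of \<open>A, B, C\<close> with nonnegative
  coefficients and integral coefficient sum.  Take the one with the smaller coefficient of \<open>C\<close>, say
  \<open>t + n1\<close>: comparing \<open>A\<close>-coordinates with the other one shows that its coefficient of \<open>A\<close> is at least \<open>k\<close>,
  and subtracting \<open>k A\<close> exhibits \<open>t\<close> as a point of \<open>S\<close> (\<open>triangle_cone.gap\<close>).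

  The algebra compares, at a maximal ideal \<open>m\<close> of \<open>R\<close>, the depth and the dimension of \<open>R\<^sub>m\<close>.
  The ring \<open>R\<close> is Noetherian because the leading exponents of an ideal are finitely generated over \<open>S\<close>, by
  the argument of Dickson's lemma (\<open>noetherian_semigroup_ring\<close>).  Depth is at most dimension because every
  regular sequence of length \<open>r\<close> yields a chain of \<open>r + 1\<close> primes (\<open>cring.prime_chain_of_regular_sequence\<close>).

  For the converse let \<open>x\<close> and \<open>y\<close> be the monomials with exponents \<open>n1\<close> and \<open>n2\<close>.  The dimension is bounded
  by counting: if \<open>P0 \<subset> P1 \<subset> P2\<close> are primes and \<open>z\<close> is transcendental over \<open>K\<close> modulo \<open>P2\<close>, then elements
  \<open>u \<in> P1 - P0\<close> and \<open>v \<in> P2 - P1\<close> are algebraically independent together with \<open>z\<close>, but the \<open>N\<^sup>3\<close> products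
  \<open>u\<^sup>i v\<^sup>j z\<^sup>k\<close> with \<open>i, j, k < N\<close> are supported on \<open>O(N\<^sup>2)\<close> lattice points
  (\<open>no_transcendental_over_prime_chain\<close>).  There are two cases.

  \<^item> The ideal \<open>m\<close> contains nonzero polynomials \<open>f(x)\<close> and \<open>g(y)\<close>.  The gap property allows division by \<open>f\<close>
    with a remainder whose exponents stay below the degree of \<open>f\<close> in direction \<open>n1\<close>, a condition that is
    preserved by multiplication with \<open>g\<close>; hence \<open>f, g\<close> is a regular sequence and the depth is at least 2
    (\<open>axis_pair.axis_polynomials_regular\<close>).  The dimension is at most 2: in a chain of four primes, an
    element of the last prime outside the third is transcendental modulo the third.

  \<^item> Otherwise \<open>x\<close> or \<open>y\<close> is transcendental modulo \<open>m\<close>, hence modulo every prime inside \<open>m\<close>, and the same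
    count gives dimension at most 1.  The depth is at least 1 unless \<open>m = 0\<close>, as \<open>R\<close> is a domain, and for
    \<open>m = 0\<close> the dimension is 0.
\<close>

section \<open>Rings of fractions\<close>

locale mult_submonoid = cring R for R (structure) +
  fixes M
  assumes M_subset: "M \<subseteq> carrier R"
    and one_M [simp, intro]: "\<one> \<in> M"
    and mult_M [simp, intro]: "s \<in> M \<Longrightarrow> t \<in> M \<Longrightarrow> s \<otimes> t \<in> M"
begin

abbreviation "L \<equiv> fraction_ring R M"
abbreviation "fr \<equiv> frac_class R M"

lemma M_carrier [simp, intro]: "s \<in> M \<Longrightarrow> s \<in> carrier R"
  using M_subset by blast

lemma equiv_frac_rel: "equiv (carrier R \<times> M) (frac_rel R M)"
proof (rule equivI)
  show "frac_rel R M \<subseteq> (carrier R \<times> M) \<times> (carrier R \<times> M)"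
    by (auto simp: frac_rel_def)
  show "refl_on (carrier R \<times> M) (frac_rel R M)"
    by (auto simp: refl_on_def frac_rel_def intro!: bexI[of _ \<one>])
  show "sym (frac_rel R M)"
    by (auto simp: sym_def frac_rel_def) metis
  show "trans (frac_rel R M)"
  proof (rule transI, clarsimp simp: frac_rel_def)
    fix a s b t c r u v
    assume [simp]: "a \<in> carrier R" "s \<in> M" "b \<in> carrier R" "t \<in> M" "c \<in> carrier R" "r \<in> M"
      "u \<in> M" "v \<in> M"
      and u: "u \<otimes> (a \<otimes> t) = u \<otimes> (b \<otimes> s)" and v: "v \<otimes> (b \<otimes> r) = v \<otimes> (c \<otimes> t)"
    have "(u \<otimes> v \<otimes> t) \<otimes> (a \<otimes> r) = (v \<otimes> r) \<otimes> (u \<otimes> (a \<otimes> t))"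
      by (simp add: m_ac)
    also have "\<dots> = (u \<otimes> s) \<otimes> (v \<otimes> (b \<otimes> r))"
      unfolding u by (simp add: m_ac)
    also have "\<dots> = (u \<otimes> v \<otimes> t) \<otimes> (c \<otimes> s)"
      unfolding v by (simp add: m_ac)
    finally show "\<exists>w\<in>M. w \<otimes> (a \<otimes> r) = w \<otimes> (c \<otimes> s)"
      by (intro bexI[of _ "u \<otimes> v \<otimes> t"]) auto
  qed
qed

lemma frac_eq_iff:
  assumes "a \<in> carrier R" "s \<in> M" "b \<in> carrier R" "t \<in> M"
  shows "fr a s = fr b t \<longleftrightarrow> (\<exists>u\<in>M. u \<otimes> (a \<otimes> t) = u \<otimes> (b \<otimes> s))"
  using eq_equiv_class_iff[OF equiv_frac_rel, of "(a, s)" "(b, t)"] assms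
  by (simp add: frac_class_def) (simp add: frac_rel_def)

lemma frac_eqI:
  assumes "a \<in> carrier R" "s \<in> M" "b \<in> carrier R" "t \<in> M" "a \<otimes> t = b \<otimes> s"
  shows "fr a s = fr b t"
  using assms by (auto simp: frac_eq_iff intro!: bexI[of _ \<one>])

lemma carrier_fraction_ring: "carrier L = {fr a s | a s. a \<in> carrier R \<and> s \<in> M}"
  by (auto simp: fraction_ring_def quotient_def frac_class_def)

lemma frac_closed [simp, intro]: "a \<in> carrier R \<Longrightarrow> s \<in> M \<Longrightarrow> fr a s \<in> carrier L"
  by (auto simp: carrier_fraction_ring)

lemma frac_cases:
  assumes "x \<in> carrier L"
  obtains a s where "a \<in> carrier R" "s \<in> M" "x = fr a s"
  using assms by (auto simp: carrier_fraction_ring)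

lemma one_fraction_ring: "\<one>\<^bsub>L\<^esub> = fr \<one> \<one>" and zero_fraction_ring: "\<zero>\<^bsub>L\<^esub> = fr \<zero> \<one>"
  by (simp_all add: fraction_ring_def)

lemma mem_frac_iff:
  assumes "a \<in> carrier R" "s \<in> M"
  shows "(b, t) \<in> fr a s \<longleftrightarrow> b \<in> carrier R \<and> t \<in> M \<and> (\<exists>u\<in>M. u \<otimes> (a \<otimes> t) = u \<otimes> (b \<otimes> s))"
  using assms by (simp add: frac_class_def) (simp add: frac_rel_def)

text \<open>
  The operations of the ring of fractions are unions over all representatives.  Once the summands are
  known to agree, such a union collapses, because the classes are nonempty.
\<close>
lemma Union_frac_const:
  assumes "a \<in> carrier R" "s \<in> M" "b \<in> carrier R" "t \<in> M"
    and "\<And>a' s' b' t'. (a', s') \<in> fr a s \<Longrightarrow> (b', t') \<in> fr b t \<Longrightarrow> F a' s' b' t' = C"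
  shows "(\<Union>(a', s')\<in>fr a s. \<Union>(b', t')\<in>fr b t. F a' s' b' t') = C"
proof -
  have "(a, s) \<in> fr a s" "(b, t) \<in> fr b t"
    using assms(1-4) by (auto simp: mem_frac_iff intro!: bexI[of _ \<one>])
  thus ?thesis
    using assms(5) by (intro equalityI subsetI) (fastforce, fast)
qed

lemma frac_mult [simp]:
  assumes [simp]: "a \<in> carrier R" "s \<in> M" "b \<in> carrier R" "t \<in> M"
  shows "fr a s \<otimes>\<^bsub>L\<^esub> fr b t = fr (a \<otimes> b) (s \<otimes> t)"
  unfolding fraction_ring_def monoid.simps ring.simps
proof (rule Union_frac_const)
  fix a' s' b' t'
  assume "(a', s') \<in> fr a s" "(b', t') \<in> fr b t"
  then obtain u v where [simp]: "a' \<in> carrier R" "s' \<in> M" "b' \<in> carrier R" "t' \<in> M" "u \<in> M" "v \<in> M"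
    and u: "u \<otimes> (a \<otimes> s') = u \<otimes> (a' \<otimes> s)" and v: "v \<otimes> (b \<otimes> t') = v \<otimes> (b' \<otimes> t)"
    by (auto simp: mem_frac_iff)
  have "(u \<otimes> v) \<otimes> ((a' \<otimes> b') \<otimes> (s \<otimes> t)) = (u \<otimes> (a' \<otimes> s)) \<otimes> (v \<otimes> (b' \<otimes> t))"
    by (simp add: m_ac)
  also have "\<dots> = (u \<otimes> v) \<otimes> ((a \<otimes> b) \<otimes> (s' \<otimes> t'))"
    unfolding u [symmetric] v [symmetric] by (simp add: m_ac)
  finally show "fr (a' \<otimes> b') (s' \<otimes> t') = fr (a \<otimes> b) (s \<otimes> t)"
    by (auto simp: frac_eq_iff intro!: bexI[of _ "u \<otimes> v"])
qed auto

lemma frac_add [simp]: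
  assumes [simp]: "a \<in> carrier R" "s \<in> M" "b \<in> carrier R" "t \<in> M"
  shows "fr a s \<oplus>\<^bsub>L\<^esub> fr b t = fr (a \<otimes> t \<oplus> b \<otimes> s) (s \<otimes> t)"
  unfolding fraction_ring_def monoid.simps ring.simps
proof (rule Union_frac_const)
  fix a' s' b' t'
  assume "(a', s') \<in> fr a s" "(b', t') \<in> fr b t"
  then obtain u v where [simp]: "a' \<in> carrier R" "s' \<in> M" "b' \<in> carrier R" "t' \<in> M" "u \<in> M" "v \<in> M"
    and u: "u \<otimes> (a \<otimes> s') = u \<otimes> (a' \<otimes> s)" and v: "v \<otimes> (b \<otimes> t') = v \<otimes> (b' \<otimes> t)"
    by (auto simp: mem_frac_iff)
  have "(u \<otimes> v) \<otimes> ((a' \<otimes> t' \<oplus> b' \<otimes> s') \<otimes> (s \<otimes> t))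
      = (u \<otimes> (a' \<otimes> s)) \<otimes> (v \<otimes> (t \<otimes> t')) \<oplus> (v \<otimes> (b' \<otimes> t)) \<otimes> (u \<otimes> (s \<otimes> s'))"
    by (simp add: m_ac l_distr r_distr)
  also have "\<dots> = (u \<otimes> v) \<otimes> ((a \<otimes> t \<oplus> b \<otimes> s) \<otimes> (s' \<otimes> t'))"
    unfolding u [symmetric] v [symmetric] by (simp add: m_ac l_distr r_distr)
  finally show "fr (a' \<otimes> t' \<oplus> b' \<otimes> s') (s' \<otimes> t') = fr (a \<otimes> t \<oplus> b \<otimes> s) (s \<otimes> t)"
    by (auto simp: frac_eq_iff intro!: bexI[of _ "u \<otimes> v"])
qed auto

lemma cring_fraction_ring: "cring L"
proof (rule cringI)
  show "abelian_group L"
  proof (rule abelian_groupI)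
    show "\<zero>\<^bsub>L\<^esub> \<in> carrier L" by (simp add: zero_fraction_ring)
  next
    fix x y assume "x \<in> carrier L" "y \<in> carrier L"
    thus "x \<oplus>\<^bsub>L\<^esub> y \<in> carrier L" by (auto elim!: frac_cases)
  next
    fix x y z assume "x \<in> carrier L" "y \<in> carrier L" "z \<in> carrier L"
    thus "x \<oplus>\<^bsub>L\<^esub> y \<oplus>\<^bsub>L\<^esub> z = x \<oplus>\<^bsub>L\<^esub> (y \<oplus>\<^bsub>L\<^esub> z)"
      by (auto elim!: frac_cases intro!: frac_eqI simp: l_distr r_distr m_ac a_ac)
  next
    fix x y assume "x \<in> carrier L" "y \<in> carrier L"
    thus "x \<oplus>\<^bsub>L\<^esub> y = y \<oplus>\<^bsub>L\<^esub> x"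
      by (auto elim!: frac_cases intro!: frac_eqI simp: l_distr r_distr m_ac a_ac)
  next
    fix x assume "x \<in> carrier L"
    thus "\<zero>\<^bsub>L\<^esub> \<oplus>\<^bsub>L\<^esub> x = x"
      by (auto elim!: frac_cases simp: zero_fraction_ring)
  next
    fix x assume "x \<in> carrier L"
    then obtain a s where [simp]: "a \<in> carrier R" "s \<in> M" and x: "x = fr a s" by (rule frac_cases)
    have "fr (\<ominus> a) s \<oplus>\<^bsub>L\<^esub> x = \<zero>\<^bsub>L\<^esub>"
      unfolding x zero_fraction_ring by (simp, intro frac_eqI) (auto simp: l_minus l_neg)
    thus "\<exists>y\<in>carrier L. y \<oplus>\<^bsub>L\<^esub> x = \<zero>\<^bsub>L\<^esub>"
      by (intro bexI[of _ "fr (\<ominus> a) s"]) auto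
  qed
  show "comm_monoid L"
  proof (rule comm_monoidI)
    show "\<one>\<^bsub>L\<^esub> \<in> carrier L" by (simp add: one_fraction_ring)
  next
    fix x y assume "x \<in> carrier L" "y \<in> carrier L"
    thus "x \<otimes>\<^bsub>L\<^esub> y \<in> carrier L" by (auto elim!: frac_cases)
  next
    fix x y z assume "x \<in> carrier L" "y \<in> carrier L" "z \<in> carrier L"
    thus "x \<otimes>\<^bsub>L\<^esub> y \<otimes>\<^bsub>L\<^esub> z = x \<otimes>\<^bsub>L\<^esub> (y \<otimes>\<^bsub>L\<^esub> z)"
      by (auto elim!: frac_cases simp: m_assoc)
  next
    fix x assume "x \<in> carrier L"
    thus "\<one>\<^bsub>L\<^esub> \<otimes>\<^bsub>L\<^esub> x = x"
      by (auto elim!: frac_cases simp: one_fraction_ring)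
  next
    fix x y assume "x \<in> carrier L" "y \<in> carrier L"
    thus "x \<otimes>\<^bsub>L\<^esub> y = y \<otimes>\<^bsub>L\<^esub> x"
      by (auto elim!: frac_cases simp: m_comm)
  qed
next
  fix x y z assume "x \<in> carrier L" "y \<in> carrier L" "z \<in> carrier L"
  thus "(x \<oplus>\<^bsub>L\<^esub> y) \<otimes>\<^bsub>L\<^esub> z = x \<otimes>\<^bsub>L\<^esub> z \<oplus>\<^bsub>L\<^esub> y \<otimes>\<^bsub>L\<^esub> z"
    by (elim frac_cases, simp, intro frac_eqI) (simp_all add: l_distr r_distr m_ac a_ac)
qed

sublocale L: cring L by (rule cring_fraction_ring)

lemma frac_hom: "ring_hom_ring R L (\<lambda>a. fr a \<one>)"
  by (rule ring_hom_ringI) (auto simp: one_fraction_ring intro: ring_axioms L.ring_axioms)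

definition contraction where "contraction J = {a \<in> carrier R. fr a \<one> \<in> J}"

lemma ideal_contraction: "ideal J L \<Longrightarrow> ideal (contraction J) R"
  unfolding contraction_def by (rule ring_hom_ring.ideal_vimage[OF frac_hom])

text \<open>
  An ideal of the ring of fractions is determined by the numerators it contains, since the fractions
  \<open>s / 1\<close> with \<open>s \<in> M\<close> are units.  This transfers the order of ideals, finite generation and primality to \<open>R\<close>.
\<close>
lemma frac_mem_ideal_iff:
  assumes "ideal J L" and [simp]: "a \<in> carrier R" "s \<in> M"
  shows "fr a s \<in> J \<longleftrightarrow> a \<in> contraction J"
proof -
  interpret ideal J L by fact
  have 1: "fr a s \<otimes>\<^bsub>L\<^esub> fr s \<one> = fr a \<one>" "fr a \<one> \<otimes>\<^bsub>L\<^esub> fr \<one> s = fr a s"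
    by (simp_all, intro frac_eqI) (simp_all add: m_ac)
  show ?thesis
    using I_r_closed[of "fr a s" "fr s \<one>"] I_r_closed[of "fr a \<one>" "fr \<one> s"]
    unfolding 1 contraction_def by auto
qed

lemma contraction_subset_iff:
  assumes J: "ideal J L" and J': "ideal J' L"
  shows "contraction J \<subseteq> contraction J' \<longleftrightarrow> J \<subseteq> J'"
proof
  assume sub: "contraction J \<subseteq> contraction J'"
  show "J \<subseteq> J'"
  proof
    fix x assume x: "x \<in> J"
    hence "x \<in> carrier L" using ideal.Icarr[OF J] by blast
    then obtain a s where as: "a \<in> carrier R" "s \<in> M" and xe: "x = fr a s" by (rule frac_cases)
    show "x \<in> J'" using x sub unfolding xe frac_mem_ideal_iff[OF J as] frac_mem_ideal_iff[OF J' as] by blast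
  qed
qed (auto simp: contraction_def)

lemma contraction_psubset:
  assumes "primeideal I L" "primeideal J L" "I \<subset> J"
  shows "contraction I \<subset> contraction J"
  using assms(3) contraction_subset_iff[OF primeideal.axioms(1)[OF assms(1)] primeideal.axioms(1)[OF assms(2)]]
    contraction_subset_iff[OF primeideal.axioms(1)[OF assms(2)] primeideal.axioms(1)[OF assms(1)]] by blast

text \<open>
  Generators of the contraction generate the ideal itself: both ideals have the same numerators.
\<close>
lemma noetherian_fraction_ring:
  assumes "noetherian_ring R"
  shows "noetherian_ring L"
proof (rule L.noetherian_ringI)
  fix J assume J: "ideal J L"
  obtain A where A: "A \<subseteq> carrier R" "finite A" "contraction J = Idl A"
    using noetherian_ring.finetely_gen[OF assms ideal_contraction[OF J]] by blast
  let ?B = "(\<lambda>a. fr a \<one>) ` A"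
  have B: "?B \<subseteq> carrier L" using A by auto
  have AJ: "A \<subseteq> contraction J" using A(3) genideal_self[OF A(1)] by simp
  have "J \<subseteq> Idl\<^bsub>L\<^esub> ?B"
  proof (subst contraction_subset_iff[OF J L.genideal_ideal[OF B], symmetric], unfold A(3), rule genideal_minimal)
    show "ideal (contraction (Idl\<^bsub>L\<^esub> ?B)) R" by (rule ideal_contraction[OF L.genideal_ideal[OF B]])
    show "A \<subseteq> contraction (Idl\<^bsub>L\<^esub> ?B)" using L.genideal_self[OF B] A(1) by (auto simp: contraction_def)
  qed
  moreover have "Idl\<^bsub>L\<^esub> ?B \<subseteq> J"
    by (rule L.genideal_minimal[OF J]) (use AJ in \<open>auto simp: contraction_def\<close>)
  ultimately show "\<exists>A\<subseteq>carrier L. finite A \<and> J = Idl\<^bsub>L\<^esub> A"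
    using A(2) B by (intro exI[of _ ?B]) auto
qed

lemma primeideal_contraction:
  assumes "primeideal J L"
  shows "primeideal (contraction J) R"
proof -
  interpret J: primeideal J L by fact
  show ?thesis
  proof (rule primeidealI[OF ideal_contraction[OF J.is_ideal] is_cring])
    show "carrier R \<noteq> contraction J"
    proof
      assume "carrier R = contraction J"
      hence "\<one>\<^bsub>L\<^esub> \<in> J" unfolding one_fraction_ring using one_closed by (auto simp: contraction_def)
      thus False using J.one_imp_carrier J.I_notcarr by blast
    qed
  next
    fix a b assume ab: "a \<in> carrier R" "b \<in> carrier R" "a \<otimes> b \<in> contraction J"
    hence "fr a \<one> \<otimes>\<^bsub>L\<^esub> fr b \<one> \<in> J" by (simp add: contraction_def)
    thus "a \<in> contraction J \<or> b \<in> contraction J"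
      using J.I_prime[of "fr a \<one>" "fr b \<one>"] ab by (auto simp: contraction_def)
  qed
qed

end

locale prime_localization = primeideal P R for P and R (structure)

sublocale prime_localization \<subseteq> mult_submonoid R "carrier R - P"
proof
  show "\<one> \<in> carrier R - P" using one_imp_carrier I_notcarr by blast
  show "s \<otimes> t \<in> carrier R - P" if "s \<in> carrier R - P" "t \<in> carrier R - P" for s t
    using that I_prime by blast
qed auto

context prime_localization
begin

definition "max_ideal = {fr a s | a s. a \<in> P \<and> s \<in> carrier R - P}"

lemma frac_mem_max_ideal_iff:
  assumes "a \<in> carrier R" "s \<in> carrier R - P"
  shows "fr a s \<in> max_ideal \<longleftrightarrow> a \<in> P"
proof
  assume "fr a s \<in> max_ideal"
  then obtain b t where b: "b \<in> P" "t \<in> carrier R - P" "fr a s = fr b t"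
    by (auto simp: max_ideal_def)
  then obtain u where u: "u \<in> carrier R - P" "u \<otimes> (a \<otimes> t) = u \<otimes> (b \<otimes> s)"
    using assms Icarr by (auto simp: frac_eq_iff)
  have "u \<otimes> (b \<otimes> s) \<in> P" using b(1,2) u(1) assms by (intro I_l_closed I_r_closed) auto
  hence "u \<otimes> (a \<otimes> t) \<in> P" using u by simp
  thus "a \<in> P" using I_prime[of u "a \<otimes> t"] I_prime[of a t] u(1) b(1,2) assms by auto
qed (use assms in \<open>auto simp: max_ideal_def\<close>)

lemma ideal_max_ideal: "ideal max_ideal L"
proof (rule idealI)
  show "ring L" by (rule L.ring_axioms)
  show "subgroup max_ideal (add_monoid L)"
  proof (rule L.add.subgroupI)
    show "max_ideal \<subseteq> carrier L" using Icarr by (auto simp: max_ideal_def)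
    show "max_ideal \<noteq> {}" using additive_subgroup.zero_closed[OF additive_subgroup_axioms] one_M
      unfolding max_ideal_def by blast
  next
    fix x y assume "x \<in> max_ideal" "y \<in> max_ideal"
    then obtain a s b t where as: "a \<in> P" "s \<in> carrier R - P" "x = fr a s"
      "b \<in> P" "t \<in> carrier R - P" "y = fr b t"
      by (auto simp: max_ideal_def)
    thus "x \<oplus>\<^bsub>L\<^esub> y \<in> max_ideal"
      using Icarr[of a] Icarr[of b]
      by (simp add: frac_mem_max_ideal_iff del: Diff_iff) (simp add: I_r_closed)
  next
    fix x assume x: "x \<in> max_ideal"
    then obtain a s where as: "a \<in> P" "s \<in> carrier R - P" "x = fr a s" by (auto simp: max_ideal_def)
    have carr: "a \<in> carrier R" "fr (\<ominus> a) s \<in> carrier L" "x \<in> carrier L" using as Icarr by auto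
    have "x \<oplus>\<^bsub>L\<^esub> fr (\<ominus> a) s = \<zero>\<^bsub>L\<^esub>"
      using carr as(1,2) unfolding as(3) zero_fraction_ring
      by (simp, intro frac_eqI) (use mult_M[OF as(2,2)] one_M in \<open>auto simp: l_minus r_neg\<close>)
    hence "\<ominus>\<^bsub>L\<^esub> x = fr (\<ominus> a) s" using carr by (metis L.minus_equality L.a_comm)
    thus "\<ominus>\<^bsub>L\<^esub> x \<in> max_ideal" using as carr
      by (simp add: frac_mem_max_ideal_iff del: Diff_iff)
  qed
next
  fix a x assume "a \<in> max_ideal" "x \<in> carrier L"
  then obtain b s c t where as: "b \<in> P" "s \<in> carrier R - P" "a = fr b s"
      "c \<in> carrier R" "t \<in> carrier R - P" "x = fr c t"
      by (auto simp: max_ideal_def elim!: frac_cases)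
  thus "x \<otimes>\<^bsub>L\<^esub> a \<in> max_ideal" "a \<otimes>\<^bsub>L\<^esub> x \<in> max_ideal"
    using Icarr[of b] by (simp_all add: frac_mem_max_ideal_iff I_r_closed I_l_closed del: Diff_iff)
qed

lemma max_ideal_ne_carrier: "max_ideal \<noteq> carrier L"
proof
  assume "max_ideal = carrier L"
  hence "fr \<one> \<one> \<in> max_ideal" using frac_closed[OF one_closed one_M] by simp
  thus False using one_M frac_mem_max_ideal_iff[OF one_closed one_M] by blast
qed

text \<open>
  A fraction \<open>a / s\<close> with \<open>a \<notin> P\<close> has the inverse \<open>s / a\<close>, so it lies in no proper ideal.
\<close>
lemma proper_ideal_subset_max_ideal:
  assumes J: "ideal J L" "J \<noteq> carrier L"
  shows "J \<subseteq> max_ideal"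
proof
  fix x assume x: "x \<in> J"
  hence "x \<in> carrier L" using ideal.Icarr[OF J(1)] by blast
  then obtain a s where as: "a \<in> carrier R" "s \<in> carrier R - P" and xe: "x = fr a s"
    by (rule frac_cases)
  show "x \<in> max_ideal"
  proof (rule ccontr)
    assume "x \<notin> max_ideal"
    hence a: "a \<in> carrier R - P" using as frac_mem_max_ideal_iff xe by auto
    have "fr s a \<in> carrier L" by (rule frac_closed) (use as a in auto)
    hence "fr a s \<otimes>\<^bsub>L\<^esub> fr s a \<in> J" using ideal.I_r_closed[OF J(1)] x xe by blast
    moreover have "fr a s \<otimes>\<^bsub>L\<^esub> fr s a = \<one>\<^bsub>L\<^esub>"
      using as a unfolding one_fraction_ring
      by (simp del: Diff_iff) (rule frac_eqI, simp_all add: m_ac del: Diff_iff)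
    ultimately show False using ideal.one_imp_carrier[OF J(1)] J(2) by simp
  qed
qed

lemma maximalideal_iff: "maximalideal J L \<longleftrightarrow> J = max_ideal"
proof
  assume "maximalideal J L"
  then interpret J: maximalideal J L .
  show "J = max_ideal"
    using J.I_maximal[OF ideal_max_ideal] proper_ideal_subset_max_ideal[OF J.is_ideal]
      J.I_notcarr ideal.Icarr[OF ideal_max_ideal] max_ideal_ne_carrier by blast
next
  assume J: "J = max_ideal"
  show "maximalideal J L"
    unfolding J
  proof (rule maximalidealI[OF ideal_max_ideal])
    show "carrier L \<noteq> max_ideal" using max_ideal_ne_carrier by simp
    show "I = max_ideal \<or> I = carrier L" if "ideal I L" "max_ideal \<subseteq> I" "I \<subseteq> carrier L" for I
      using proper_ideal_subset_max_ideal[of I] that by blast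
  qed
qed

lemma contraction_subset_prime:
  assumes "primeideal J L"
  shows "contraction J \<subseteq> P"
proof
  interpret J: primeideal J L by fact
  fix a assume "a \<in> contraction J"
  hence a: "a \<in> carrier R" "fr a \<one> \<in> J" by (auto simp: contraction_def)
  hence "fr a \<one> \<in> max_ideal" using proper_ideal_subset_max_ideal[OF J.is_ideal] J.I_notcarr by blast
  thus "a \<in> P" using frac_mem_max_ideal_iff[OF a(1) one_M] by blast
qed

end

section \<open>Regular sequences and chains of prime ideals\<close>

lemma (in cring) nonzerodivisor_quot_iff:
  assumes I: "ideal I R" and x: "x \<in> carrier R"
  shows "nonzerodivisor (R Quot I) (I +> x) \<longleftrightarrow> (\<forall>y\<in>carrier R. x \<otimes> y \<in> I \<longrightarrow> y \<in> I)"
proof -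
  interpret I: ideal I R by fact
  have carr: "carrier (R Quot I) = (+>) I ` carrier R"
    by (auto simp: FactRing_simps)
  have zero: "I +> y = I \<longleftrightarrow> y \<in> I" if "y \<in> carrier R" for y
    using that I.rcos_const_imp_mem I.a_rcos_const by blast
  show ?thesis
    unfolding nonzerodivisor_def carr
    using x by (simp add: FactRing_def I.rcoset_mult_add zero)
qed

text \<open>
  Regularity expressed by ideal membership in the ring itself, without its quotients.
\<close>
lemma (in cring) regular_sequence_iff:
  "regular_sequence R xs \<longleftrightarrow> set xs \<subseteq> carrier R \<and>
     (\<forall>i<length xs. \<forall>y\<in>carrier R.
        xs ! i \<otimes> y \<in> Idl (set (take i xs)) \<longrightarrow> y \<in> Idl (set (take i xs))) \<and>
     Idl (set xs) \<noteq> carrier R"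
proof (cases "set xs \<subseteq> carrier R")
  case True
  have "ideal (Idl (set (take i xs))) R" for i
    by (rule genideal_ideal) (use True set_take_subset in fastforce)
  moreover have "xs ! i \<in> carrier R" if "i < length xs" for i
    using True that nth_mem by blast
  ultimately show ?thesis
    by (simp add: regular_sequence_def nonzerodivisor_quot_iff)
qed (simp add: regular_sequence_def)

text \<open>
  An ideal that is maximal among those containing \<open>I\<close> and missing \<open>M\<close> is prime: if it contained neither of
  two elements, enlarging it by either one would reach \<open>M\<close>, and the product of the two elements of \<open>M\<close> found
  in this way would lie in the ideal if the product of the two elements did.
\<close>
lemma (in cring) prime_ideal_avoiding:
  assumes "noetherian_ring R" and I: "ideal I R"
    and M: "M \<subseteq> carrier R" "\<one> \<in> M" "\<And>s t. s \<in> M \<Longrightarrow> t \<in> M \<Longrightarrow> s \<otimes> t \<in> M"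
    and disj: "I \<inter> M = {}"
  obtains P where "primeideal P R" "I \<subseteq> P" "P \<inter> M = {}"
proof -
  interpret N: noetherian_ring R by fact
  let ?A = "{J. ideal J R \<and> I \<subseteq> J \<and> J \<inter> M = {}}"
  have "\<exists>P\<in>?A. \<forall>X\<in>?A. P \<subseteq> X \<longrightarrow> X = P"
  proof (rule subset_Zorn_nonempty)
    show "?A \<noteq> {}" using I disj by blast
    show "\<Union>C \<in> ?A" if "C \<noteq> {}" "subset.chain ?A C" for C
    proof -
      have "subset.chain {I. ideal I R} C" using that(2) by (auto simp: subset.chain_def)
      hence "\<Union>C \<in> C" using N.ideal_chain_is_trivial that(1) by blast
      thus ?thesis using that(2) by (auto simp: subset.chain_def)
    qed
  qed
  then obtain P where P: "ideal P R" "I \<subseteq> P" "P \<inter> M = {}"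
    and max: "\<And>X. ideal X R \<Longrightarrow> I \<subseteq> X \<Longrightarrow> X \<inter> M = {} \<Longrightarrow> P \<subseteq> X \<Longrightarrow> X = P"
    by auto
  interpret P: ideal P R by fact
  have meets: "\<exists>p\<in>P. \<exists>r\<in>carrier R. p \<oplus> r \<otimes> a \<in> M" if a: "a \<in> carrier R" "a \<notin> P" for a
  proof -
    let ?J = "P <+>\<^bsub>R\<^esub> PIdl a"
    have J: "ideal ?J R" using a by (intro add_ideals P cgenideal_ideal)
    have mem: "x \<in> ?J \<longleftrightarrow> (\<exists>p\<in>P. \<exists>r\<in>carrier R. x = p \<oplus> r \<otimes> a)" for x
      by (auto simp: set_add_def' cgenideal_def)
    have "P \<subseteq> ?J"
    proof
      fix p assume p: "p \<in> P"
      hence "p = p \<oplus> \<zero> \<otimes> a" using P.Icarr a by simp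
      thus "p \<in> ?J" unfolding mem using p by blast
    qed
    moreover have "a \<in> ?J"
    proof -
      have "a = \<zero> \<oplus> \<one> \<otimes> a" using a by simp
      moreover have "\<zero> \<in> P" by (rule P.zero_closed)
      ultimately show ?thesis unfolding mem by blast
    qed
    ultimately have "?J \<inter> M \<noteq> {}"
      using max[OF J] P(2) a by blast
    thus ?thesis by (auto simp: mem)
  qed
  have "primeideal P R"
  proof (rule primeidealI[OF P(1) is_cring])
    show "carrier R \<noteq> P" using P(3) M(2) by blast
  next
    fix a b assume ab: "a \<in> carrier R" "b \<in> carrier R" "a \<otimes> b \<in> P"
    show "a \<in> P \<or> b \<in> P"
    proof (rule ccontr)
      assume "\<not> (a \<in> P \<or> b \<in> P)"
      then obtain p r q s where pq: "p \<in> P" "r \<in> carrier R" "p \<oplus> r \<otimes> a \<in> M"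
        "q \<in> P" "s \<in> carrier R" "q \<oplus> s \<otimes> b \<in> M"
        using meets ab by metis
      hence [simp]: "p \<in> carrier R" "q \<in> carrier R" "r \<in> carrier R" "s \<in> carrier R" "a \<in> carrier R" "b \<in> carrier R"
        using P.Icarr ab by auto
      have "(p \<oplus> r \<otimes> a) \<otimes> (q \<oplus> s \<otimes> b) = p \<otimes> (q \<oplus> s \<otimes> b) \<oplus> ((r \<otimes> a) \<otimes> q \<oplus> (r \<otimes> s) \<otimes> (a \<otimes> b))"
        by (simp add: l_distr r_distr m_ac a_ac)
      moreover have "\<dots> \<in> P"
        using P.I_r_closed[OF pq(1)] P.I_l_closed[OF pq(4)] P.I_l_closed[OF ab(3)]
        by (intro P.a_closed) auto
      ultimately show False using M(3)[OF pq(3,6)] P(3) by auto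
    qed
  qed
  thus ?thesis using that P by blast
qed

text \<open>
  The chain is built downwards from \<open>Q\<close>.  Let \<open>I\<close> be generated by the entries before the last one \<open>x\<close>.  As
  \<open>x\<close> is a nonzerodivisor modulo \<open>I\<close> and \<open>I \<subseteq> Q\<close>, no product of a power of \<open>x\<close> with an element outside \<open>Q\<close>
  lies in \<open>I\<close>.  A prime over \<open>I\<close> avoiding all these products is contained in \<open>Q\<close> and misses \<open>x \<in> Q\<close>.
\<close>
lemma (in cring) prime_chain_of_regular_sequence:
  assumes N: "noetherian_ring R"
    and xs: "set xs \<subseteq> carrier R"
      "\<And>i y. i < length xs \<Longrightarrow> y \<in> carrier R \<Longrightarrow>
        xs ! i \<otimes> y \<in> Idl (set (take i xs)) \<Longrightarrow> y \<in> Idl (set (take i xs))"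
    and "j \<le> length xs" "primeideal Q R" "set (take j xs) \<subseteq> Q"
  shows "\<exists>P. (\<forall>i\<le>j. primeideal (P i) R) \<and> (\<forall>i<j. P i \<subset> P (Suc i)) \<and> P j = Q"
  using assms(4-)
proof (induction j arbitrary: Q)
  case 0
  thus ?case by (intro exI[of _ "\<lambda>_. Q"]) auto
next
  case (Suc j)
  interpret Q: primeideal Q R by fact
  define I x where "I = Idl (set (take j xs))" and "x = xs ! j"
  have take_carr: "set (take j xs) \<subseteq> carrier R" using xs(1) set_take_subset by fastforce
  have I: "ideal I R" unfolding I_def by (rule genideal_ideal[OF take_carr])
  interpret I: ideal I R by fact
  have x: "x \<in> Q" "x \<in> carrier R"
    using Suc.prems xs(1) by (auto simp: x_def take_Suc_conv_app_nth)
  have IQ: "I \<subseteq> Q" unfolding I_def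
    by (rule genideal_minimal[OF Q.is_ideal]) (use Suc.prems in \<open>auto simp: take_Suc_conv_app_nth\<close>)
  define M where "M = {s \<otimes> x [^] k | s k. s \<in> carrier R - Q \<and> k \<in> (UNIV :: nat set)}"
  have M_I: "s \<otimes> x [^] k \<in> M" if "s \<in> carrier R - Q" for s and k :: nat
    using that unfolding M_def by blast
  have M_E: "\<exists>s (k::nat). s \<in> carrier R - Q \<and> y = s \<otimes> x [^] k" if "y \<in> M" for y
    using that unfolding M_def by blast
  have one: "\<one> \<in> carrier R - Q" using Q.one_imp_carrier Q.I_notcarr by blast
  have "I \<inter> M = {}"
  proof (rule ccontr)
    assume "I \<inter> M \<noteq> {}"
    then obtain s and k :: nat where s: "s \<in> carrier R - Q" "s \<otimes> x [^] k \<in> I" using M_E by blast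
    have "s \<in> I" using s(2)
    proof (induction k)
      case 0
      thus ?case using s(1) by simp
    next
      case (Suc k)
      have "x \<otimes> (s \<otimes> x [^] k) = s \<otimes> x [^] Suc k" using s(1) x by (simp add: m_ac)
      hence "s \<otimes> x [^] k \<in> I"
        using xs(2)[of j "s \<otimes> x [^] k"] Suc.prems \<open>Suc j \<le> length xs\<close> s(1) x unfolding I_def x_def by simp
      thus ?case by (rule Suc.IH)
    qed
    thus False using IQ s(1) by blast
  qed
  moreover have "M \<subseteq> carrier R"
  proof
    fix y assume "y \<in> M"
    then obtain s and k :: nat where "s \<in> carrier R - Q" "y = s \<otimes> x [^] k" using M_E by blast
    thus "y \<in> carrier R" using x by simp
  qed
  moreover have "\<one> \<in> M" using M_I[OF one, of 0] by simp
  moreover have "u \<otimes> v \<in> M" if u: "u \<in> M" and v: "v \<in> M" for u v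
  proof -
    obtain s and k :: nat where s: "s \<in> carrier R - Q" "u = s \<otimes> x [^] k"
      using M_E[OF u] by blast
    obtain t and l :: nat where t: "t \<in> carrier R - Q" "v = t \<otimes> x [^] l"
      using M_E[OF v] by blast
    have "s \<otimes> t \<in> carrier R - Q" using s(1) t(1) Q.I_prime by blast
    moreover have "u \<otimes> v = (s \<otimes> t) \<otimes> x [^] (k + l)"
      using s t x by (simp add: m_ac flip: nat_pow_mult)
    ultimately show ?thesis using M_I by simp
  qed
  ultimately obtain P where P: "primeideal P R" "I \<subseteq> P" "P \<inter> M = {}"
    using prime_ideal_avoiding[OF N I, of M] by metis
  have "s \<in> Q" if "s \<in> P" for s
  proof (rule ccontr)
    assume "s \<notin> Q"
    moreover have "s \<in> carrier R" using that ideal.Icarr[OF primeideal.axioms(1)[OF P(1)]] by blast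
    ultimately have "s \<in> M" using M_I[of s 0] by simp
    thus False using that P(3) by blast
  qed
  moreover have "x \<in> M" using M_I[OF one, of 1] x by simp
  ultimately have PQ: "P \<subset> Q" using x P(3) by blast
  have "set (take j xs) \<subseteq> P" using P(2) genideal_self[OF take_carr] unfolding I_def by blast
  then obtain C where C: "\<forall>i\<le>j. primeideal (C i) R" "\<forall>i<j. C i \<subset> C (Suc i)" "C j = P"
    using Suc.IH[OF _ P(1)] Suc.prems by auto
  show ?case
  proof (intro exI[of _ "\<lambda>i. if i \<le> j then C i else Q"] conjI allI impI)
    fix i
    show "primeideal (if i \<le> j then C i else Q) R" using C(1) Suc.prems by simp
    show "(if i \<le> j then C i else Q) \<subset> (if Suc i \<le> j then C (Suc i) else Q)" if "i < Suc j"
      using that C(2,3) PQ by (cases "i = j") simp_all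
  qed simp
qed

lemma (in cring) depth_le_krull_dim:
  assumes N: "noetherian_ring R" and "primeideal Q R"
  shows "depth R Q \<le> krull_dim R"
  unfolding depth_def
proof (rule SUP_least, clarify)
  fix xs assume "regular_sequence R xs" "set xs \<subseteq> Q"
  then obtain P where "\<forall>i\<le>length xs. primeideal (P i) R" "\<forall>i<length xs. P i \<subset> P (Suc i)"
    using prime_chain_of_regular_sequence[OF N, of xs "length xs" Q] assms(2)
    by (auto simp: regular_sequence_iff)
  thus "enat (length xs) \<le> krull_dim R"
    unfolding krull_dim_def by (intro SUP_upper) auto
qed

text \<open>
  It suffices to exclude chains of exactly \<open>n + 2\<close> primes, because longer ones can be truncated.
\<close>
lemma krull_dim_le:
  assumes "\<And>P. (\<And>i. i \<le> Suc n \<Longrightarrow> primeideal (P i) R) \<Longrightarrow> (\<And>i. i < Suc n \<Longrightarrow> P i \<subset> P (Suc i)) \<Longrightarrow> False"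
  shows "krull_dim R \<le> enat n"
  unfolding krull_dim_def
proof (rule SUP_least, clarify)
  fix k P assume "\<forall>i\<le>k. primeideal (P i) R" "\<forall>i<k. P i \<subset> P (Suc i)"
  thus "enat k \<le> enat n"
    using assms[of P] by (cases "k \<le> n") auto
qed

section \<open>Regular sequences in a localization\<close>

lemma (in cring) Idl_empty: "Idl {} = {\<zero>}"
  using genideal_minimal[OF zeroideal, of "{}"]
    additive_subgroup.zero_closed[OF ideal.axioms(1)[OF genideal_ideal[of "{}"]]] by auto

context prime_localization
begin

text \<open>
  The next two lemmas clear denominators: a relation between fractions becomes one in \<open>R\<close> after
  multiplication with an element outside \<open>P\<close>, and that element can be absorbed into the unknown.
\<close>
lemma frac_nonzerodivisor:
  assumes f: "f \<in> carrier R" "\<And>y. y \<in> carrier R \<Longrightarrow> f \<otimes> y = \<zero> \<Longrightarrow> y = \<zero>"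
    and x: "x \<in> carrier L" "fr f \<one> \<otimes>\<^bsub>L\<^esub> x = \<zero>\<^bsub>L\<^esub>"
  shows "x = \<zero>\<^bsub>L\<^esub>"
proof -
  obtain a s where as: "a \<in> carrier R" "s \<in> carrier R - P" "x = fr a s"
    using x(1) by (rule frac_cases)
  have sc: "s \<in> carrier R" using as(2) by blast
  have "fr (f \<otimes> a) (\<one> \<otimes> s) = fr \<zero> \<one>"
    using x(2) unfolding as(3) frac_mult[OF f(1) one_M as(1,2)] zero_fraction_ring .
  then obtain u where u: "u \<in> carrier R - P" "u \<otimes> ((f \<otimes> a) \<otimes> \<one>) = u \<otimes> (\<zero> \<otimes> (\<one> \<otimes> s))"
    using frac_eq_iff[of "f \<otimes> a" "\<one> \<otimes> s" \<zero> \<one>] f(1) as(1) mult_M[OF one_M as(2)] one_M by blast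
  have uc: "u \<in> carrier R" using u(1) by blast
  have "f \<otimes> (u \<otimes> a) = \<zero>" using u(2) uc f(1) as(1) sc by (simp add: m_ac)
  hence "u \<otimes> a = \<zero>" using f(2) uc as(1) by simp
  hence "u \<otimes> (a \<otimes> \<one>) = u \<otimes> (\<zero> \<otimes> s)" using uc as(1) sc by simp
  thus ?thesis
    unfolding as(3) zero_fraction_ring using frac_eq_iff[OF as(1,2) zero_closed one_M] u(1) by blast
qed

lemma frac_mem_principal:
  assumes f: "f \<in> carrier R" and g: "g \<in> carrier R"
    and fg: "\<And>y q. y \<in> carrier R \<Longrightarrow> q \<in> carrier R \<Longrightarrow> g \<otimes> y = f \<otimes> q \<Longrightarrow> \<exists>h\<in>carrier R. y = f \<otimes> h"
    and x: "x \<in> carrier L" "y \<in> carrier L" "fr g \<one> \<otimes>\<^bsub>L\<^esub> x = y \<otimes>\<^bsub>L\<^esub> fr f \<one>"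
  shows "\<exists>z\<in>carrier L. x = z \<otimes>\<^bsub>L\<^esub> fr f \<one>"
proof -
  obtain a s where as: "a \<in> carrier R" "s \<in> carrier R - P" "x = fr a s"
    using x(1) by (rule frac_cases)
  obtain b t where bt: "b \<in> carrier R" "t \<in> carrier R - P" "y = fr b t"
    using x(2) by (rule frac_cases)
  have carr: "s \<in> carrier R" "t \<in> carrier R" using as(2) bt(2) by blast+
  have "fr (g \<otimes> a) (\<one> \<otimes> s) = fr (b \<otimes> f) (t \<otimes> \<one>)"
    using x(3) unfolding as(3) bt(3) frac_mult[OF g one_M as(1,2)] frac_mult[OF bt(1,2) f one_M] .
  then obtain u where u: "u \<in> carrier R - P" "u \<otimes> ((g \<otimes> a) \<otimes> (t \<otimes> \<one>)) = u \<otimes> ((b \<otimes> f) \<otimes> (\<one> \<otimes> s))"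
    using frac_eq_iff[of "g \<otimes> a" "\<one> \<otimes> s" "b \<otimes> f" "t \<otimes> \<one>"] f g as(1) bt(1)
      mult_M[OF one_M as(2)] mult_M[OF bt(2) one_M] by blast
  have uc: "u \<in> carrier R" using u(1) by blast
  have eq: "g \<otimes> (u \<otimes> t \<otimes> a) = f \<otimes> (u \<otimes> b \<otimes> s)"
    using u(2) uc f g as(1) bt(1) carr by (simp add: m_ac)
  have "u \<otimes> t \<otimes> a \<in> carrier R" "u \<otimes> b \<otimes> s \<in> carrier R"
    by (intro m_closed uc carr as(1) bt(1))+
  from fg[OF this eq] obtain h where h: "h \<in> carrier R" "u \<otimes> t \<otimes> a = f \<otimes> h" ..
  define w where "w = u \<otimes> t \<otimes> s"
  have w: "w \<in> carrier R - P"
    unfolding w_def by (intro mult_M u(1) bt(2) as(2))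
  have wc: "w \<in> carrier R" using w by blast
  have "a \<otimes> w = (u \<otimes> t \<otimes> a) \<otimes> s" using uc carr as(1) by (simp add: w_def m_ac)
  also have "\<dots> = (h \<otimes> f) \<otimes> s" unfolding h(2) using f h(1) by (simp add: m_comm)
  finally have "a \<otimes> (w \<otimes> \<one>) = (h \<otimes> f) \<otimes> s" using wc by simp
  hence "fr a s = fr (h \<otimes> f) (w \<otimes> \<one>)"
    by (rule frac_eqI[OF as(1,2) m_closed[OF h(1) f] mult_M[OF w one_M]])
  hence "x = fr h w \<otimes>\<^bsub>L\<^esub> fr f \<one>" unfolding as(3) frac_mult[OF h(1) w f one_M] .
  thus ?thesis using frac_closed[OF h(1) w] by blast
qed

lemma Idl_fracs_ne_carrier:
  assumes "F \<subseteq> P"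
  shows "Idl\<^bsub>L\<^esub> ((\<lambda>f. fr f \<one>) ` F) \<noteq> carrier L"
proof -
  have "(\<lambda>f. fr f \<one>) ` F \<subseteq> max_ideal" using assms one_M unfolding max_ideal_def by blast
  hence "Idl\<^bsub>L\<^esub> ((\<lambda>f. fr f \<one>) ` F) \<subseteq> max_ideal" by (rule L.genideal_minimal[OF ideal_max_ideal])
  thus ?thesis using max_ideal_ne_carrier ideal.Icarr[OF ideal_max_ideal] by blast
qed

lemma frac_in_max_ideal: "f \<in> P \<Longrightarrow> fr f \<one> \<in> max_ideal"
  using one_M unfolding max_ideal_def by blast

lemma one_le_depth:
  assumes f: "f \<in> P" "\<And>y. y \<in> carrier R \<Longrightarrow> f \<otimes> y = \<zero> \<Longrightarrow> y = \<zero>"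
  shows "enat 1 \<le> depth L max_ideal"
proof -
  have fc: "f \<in> carrier R" by (rule Icarr[OF f(1)])
  have "regular_sequence L [fr f \<one>]"
    unfolding L.regular_sequence_iff
    using frac_nonzerodivisor[OF fc f(2)] Idl_fracs_ne_carrier[of "{f}"] f(1) frac_closed[OF fc one_M]
    by (simp add: L.Idl_empty)
  thus ?thesis
    unfolding depth_def using frac_in_max_ideal[OF f(1)] by (intro SUP_upper2[of "[fr f \<one>]"]) auto
qed

lemma two_le_depth:
  assumes f: "f \<in> P" "\<And>y. y \<in> carrier R \<Longrightarrow> f \<otimes> y = \<zero> \<Longrightarrow> y = \<zero>"
    and g: "g \<in> P"
      "\<And>y q. y \<in> carrier R \<Longrightarrow> q \<in> carrier R \<Longrightarrow> g \<otimes> y = f \<otimes> q \<Longrightarrow> \<exists>h\<in>carrier R. y = f \<otimes> h"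
  shows "enat 2 \<le> depth L max_ideal"
proof -
  have fc: "f \<in> carrier R" by (rule Icarr[OF f(1)])
  have gc: "g \<in> carrier R" by (rule Icarr[OF g(1)])
  have flc: "fr f \<one> \<in> carrier L" and glc: "fr g \<one> \<in> carrier L"
    using frac_closed[OF _ one_M] fc gc by auto
  have Idl_f: "x \<in> Idl\<^bsub>L\<^esub> {fr f \<one>} \<longleftrightarrow> (\<exists>z\<in>carrier L. x = z \<otimes>\<^bsub>L\<^esub> fr f \<one>)" for x
    unfolding L.cgenideal_eq_genideal[OF flc, symmetric] cgenideal_def by blast
  have "regular_sequence L [fr f \<one>, fr g \<one>]"
    unfolding L.regular_sequence_iff
  proof (intro conjI allI impI ballI)
    show "set [fr f \<one>, fr g \<one>] \<subseteq> carrier L" using flc glc by simp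
    show "Idl\<^bsub>L\<^esub> (set [fr f \<one>, fr g \<one>]) \<noteq> carrier L"
      using Idl_fracs_ne_carrier[of "{f, g}"] f(1) g(1) by simp
  next
    fix i x
    assume i: "i < length [fr f \<one>, fr g \<one>]" and x: "x \<in> carrier L"
      and mem: "[fr f \<one>, fr g \<one>] ! i \<otimes>\<^bsub>L\<^esub> x \<in> Idl\<^bsub>L\<^esub> (set (take i [fr f \<one>, fr g \<one>]))"
    consider "i = 0" | "i = 1" using i by fastforce
    thus "x \<in> Idl\<^bsub>L\<^esub> (set (take i [fr f \<one>, fr g \<one>]))"
    proof cases
      case 1
      thus ?thesis using mem frac_nonzerodivisor[OF fc f(2) x] by (simp add: L.Idl_empty)
    next
      case 2
      have "fr g \<one> \<otimes>\<^bsub>L\<^esub> x \<in> Idl\<^bsub>L\<^esub> {fr f \<one>}" using mem 2 by simp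
      then obtain y where y: "y \<in> carrier L" "fr g \<one> \<otimes>\<^bsub>L\<^esub> x = y \<otimes>\<^bsub>L\<^esub> fr f \<one>" unfolding Idl_f by blast
      have "x \<in> Idl\<^bsub>L\<^esub> {fr f \<one>}" unfolding Idl_f by (rule frac_mem_principal[OF fc gc g(2) x y])
      thus ?thesis using 2 by simp
    qed
  qed
  thus ?thesis
    unfolding depth_def using frac_in_max_ideal f(1) g(1)
    by (intro SUP_upper2[of "[fr f \<one>, fr g \<one>]"]) auto
qed

end

section \<open>Leading exponents in semigroup rings\<close>

abbreviation "keys \<equiv> Poly_Mapping.keys"
abbreviation "lookup \<equiv> Poly_Mapping.lookup"
abbreviation "single \<equiv> Poly_Mapping.single"

text \<open>
  A monomial order on \<open>\<nat>\<^sup>2\<close>: by unique factorization the weight is an embedding into the multiplicative monoid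
  of the positive integers, whose usual order is a well-order compatible with multiplication.
\<close>
definition weight :: "nat \<times> nat \<Rightarrow> nat" where
  "weight s = 2 ^ fst s * 3 ^ snd s"

lemma weight_pos [simp]: "weight s > 0"
  by (simp add: weight_def)

lemma weight_zero [simp]: "weight 0 = 1"
  by (simp add: weight_def)

lemma weight_add: "weight (s + t) = weight s * weight t"
  by (simp add: weight_def power_add)

lemma inj_weight: "inj weight"
proof (rule injI)
  have mult: "multiplicity 2 (weight s) = fst s" "multiplicity 3 (weight s) = snd s" for s
    by (simp_all add: weight_def prime_elem_multiplicity_mult_distrib prime_elem_multiplicity_power_distrib
        not_dvd_imp_multiplicity_0)
  fix s t assume "weight s = weight t"
  thus "s = t" by (metis mult prod_eqI)
qed

text \<open>
  The multiple \<open>k s\<close> of a lattice point, so that the \<open>k\<close>-th power of the monomial at \<open>s\<close> has exponent \<open>nmul k s\<close>.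
\<close>
definition nmul :: "nat \<Rightarrow> nat \<times> nat \<Rightarrow> nat \<times> nat" where
  "nmul k s = (k * fst s, k * snd s)"

lemma nmul_simps [simp]: "nmul 0 s = 0" "nmul (Suc k) s = s + nmul k s" "nmul 1 s = s"
  by (auto simp: nmul_def zero_prod_def plus_prod_def)

lemma nmul_add: "nmul (k + l) s = nmul k s + nmul l s"
  by (auto simp: nmul_def plus_prod_def algebra_simps)

lemma weight_nmul: "weight (nmul k s) = weight s ^ k"
  by (induction k) (simp_all add: weight_add)

lemma leading_exponent:
  assumes "p \<noteq> (0 :: (nat \<times> nat) \<Rightarrow>\<^sub>0 'k::zero)"
  obtains s where "s \<in> keys p" "\<And>t. t \<in> keys p \<Longrightarrow> weight t \<le> weight s"
proof -
  have "keys p \<noteq> {}" using assms by simp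
  hence "Max (weight ` keys p) \<in> weight ` keys p" by (intro Max_in) auto
  then obtain s where "s \<in> keys p" "weight s = Max (weight ` keys p)" by auto
  thus ?thesis using that[of s] by simp
qed

text \<open>
  The exponent \<open>s + u\<close> of the product arises only from the pair \<open>(s, u)\<close>: a smaller weight in one factor
  cannot be compensated by the other.
\<close>
lemma lookup_mult_leading:
  fixes p q :: "(nat \<times> nat) \<Rightarrow>\<^sub>0 'k::semiring_0"
  assumes p: "\<And>t. t \<in> keys p \<Longrightarrow> weight t \<le> weight s"
    and q: "\<And>t. t \<in> keys q \<Longrightarrow> weight t \<le> weight u"
  shows "lookup (p * q) (s + u) = lookup p s * lookup q u"
proof -
  have coeff: "lookup p l * Sum_any (\<lambda>r. lookup q r when s + u = l + r)
      = ((lookup p s * lookup q u) when (l = s))" for l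
  proof (cases "l = s")
    case True
    thus ?thesis by simp
  next
    case False
    have "lookup p l * (lookup q r when s + u = l + r) = 0" for r
    proof (rule ccontr)
      assume "lookup p l * (lookup q r when s + u = l + r) \<noteq> 0"
      hence lr: "l \<in> keys p" "r \<in> keys q" "s + u = l + r"
        by (auto simp: when_def in_keys_iff split: if_splits)
      have "weight l \<noteq> weight s" using False injD[OF inj_weight] by blast
      hence "weight l < weight s" "weight r \<le> weight u" using p[OF lr(1)] q[OF lr(2)] by auto
      hence "weight l * weight r < weight s * weight u"
        by (intro mult_less_le_imp_less) auto
      thus False using arg_cong[OF lr(3), of weight] by (simp add: weight_add)
    qed
    moreover have "finite {r. (lookup q r when s + u = l + r) \<noteq> 0}"
      by (rule finite_subset[of _ "keys q"]) (auto simp: in_keys_iff when_def)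
    ultimately show ?thesis using False by (subst Sum_any_right_distrib) simp_all
  qed
  show ?thesis unfolding lookup_mult coeff by simp
qed

lemma poly_mult_eq_0_iff:
  fixes p q :: "(nat \<times> nat) \<Rightarrow>\<^sub>0 'k::field"
  shows "p * q = 0 \<longleftrightarrow> p = 0 \<or> q = 0"
proof
  assume pq: "p * q = 0"
  show "p = 0 \<or> q = 0"
  proof (rule ccontr)
    assume "\<not> (p = 0 \<or> q = 0)"
    hence "p \<noteq> 0" "q \<noteq> 0" by auto
    obtain s where s: "s \<in> keys p" "\<And>u. u \<in> keys p \<Longrightarrow> weight u \<le> weight s"
      using leading_exponent[OF \<open>p \<noteq> 0\<close>] by blast
    obtain t where t: "t \<in> keys q" "\<And>u. u \<in> keys q \<Longrightarrow> weight u \<le> weight t"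
      using leading_exponent[OF \<open>q \<noteq> 0\<close>] by blast
    have "lookup p s * lookup q t = 0"
      using lookup_mult_leading[of p s q t] s(2) t(2) pq by simp
    thus False using s(1) t(1) by (simp add: in_keys_iff)
  qed
qed auto

lemma is_submonoidI:
  "0 \<in> S \<Longrightarrow> (\<And>x y. x \<in> S \<Longrightarrow> y \<in> S \<Longrightarrow> x + y \<in> S) \<Longrightarrow> is_submonoid S"
  by (simp add: is_submonoid_def)

lemma is_submonoidD:
  assumes "is_submonoid S"
  shows "0 \<in> S" "x \<in> S \<Longrightarrow> y \<in> S \<Longrightarrow> x + y \<in> S"
  using assms by (simp_all add: is_submonoid_def)

lemma semigroup_ring_simps [simp]:
  "carrier (semigroup_ring S) = {p. keys p \<subseteq> S}" "x \<otimes>\<^bsub>semigroup_ring S\<^esub> y = x * y"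
  "x \<oplus>\<^bsub>semigroup_ring S\<^esub> y = x + y" "\<one>\<^bsub>semigroup_ring S\<^esub> = 1" "\<zero>\<^bsub>semigroup_ring S\<^esub> = 0"
  by (simp_all add: semigroup_ring_def)

lemma keys_mult_subset:
  assumes "is_submonoid S" "keys p \<subseteq> S" "keys q \<subseteq> S"
  shows "keys (p * q) \<subseteq> S"
  using keys_mult[of p q] assms by (force simp: is_submonoid_def)

lemma keys_add_subset: "keys p \<subseteq> S \<Longrightarrow> keys q \<subseteq> S \<Longrightarrow> keys (p + q) \<subseteq> S"
  using keys_add[of p q] by blast

lemma cring_semigroup_ring:
  assumes S: "is_submonoid S"
  shows "cring (semigroup_ring S :: ('a::comm_monoid_add \<Rightarrow>\<^sub>0 'k::field) ring)"
proof (rule cringI)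
  show "abelian_group (semigroup_ring S :: ('a \<Rightarrow>\<^sub>0 'k) ring)"
  proof (rule abelian_groupI)
    fix p :: "'a \<Rightarrow>\<^sub>0 'k" assume "p \<in> carrier (semigroup_ring S)"
    thus "\<exists>q\<in>carrier (semigroup_ring S). q \<oplus>\<^bsub>semigroup_ring S\<^esub> p = \<zero>\<^bsub>semigroup_ring S\<^esub>"
      by (intro bexI[of _ "- p"]) (auto simp: in_keys_iff)
  qed (auto simp: keys_add_subset add_ac)
  show "comm_monoid (semigroup_ring S :: ('a \<Rightarrow>\<^sub>0 'k) ring)"
    by (rule comm_monoidI) (use S in \<open>auto simp: keys_mult_subset mult_ac is_submonoid_def\<close>)
qed (auto simp: algebra_simps)

section \<open>Semigroup rings of finitely generated monoids are Noetherian\<close>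

text \<open>
  Divisibility in \<open>S\<close> is a well-quasi-order.  The formulation with a whole increasing subsequence, instead of
  a single increasing pair, passes directly to sums of two monoids.
\<close>
definition dickson :: "'a::comm_monoid_add set \<Rightarrow> bool" where
  "dickson S \<longleftrightarrow> (\<forall>f :: nat \<Rightarrow> 'a. range f \<subseteq> S \<longrightarrow>
     (\<exists>\<phi> :: nat \<Rightarrow> nat. strict_mono \<phi> \<and> (\<forall>i j. i < j \<longrightarrow> (\<exists>t\<in>S. f (\<phi> j) = f (\<phi> i) + t))))"

lemma nondecreasing_subseq:
  fixes c :: "nat \<Rightarrow> nat"
  obtains \<phi> :: "nat \<Rightarrow> nat" where "strict_mono \<phi>" "\<And>i j. i \<le> j \<Longrightarrow> c (\<phi> i) \<le> c (\<phi> j)"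
proof -
  obtain \<phi> :: "nat \<Rightarrow> nat" where \<phi>: "strict_mono \<phi>" "monoseq (\<lambda>n. c (\<phi> n))"
    using seq_monosub[of c] by blast
  from \<phi>(2) consider "\<And>i j. i \<le> j \<Longrightarrow> c (\<phi> i) \<le> c (\<phi> j)" | "\<And>i j. i \<le> j \<Longrightarrow> c (\<phi> j) \<le> c (\<phi> i)"
    by (auto simp: monoseq_def)
  thus ?thesis
  proof cases
    case 1
    thus ?thesis using \<phi>(1) that by blast
  next
    case 2
    obtain n where n: "\<And>i. c (\<phi> n) \<le> c (\<phi> i)"
      using ex_has_least_nat[of "\<lambda>_. True" 0 "\<lambda>n. c (\<phi> n)"] by auto
    have "c (\<phi> (n + i)) = c (\<phi> n)" for i
      using n[of "n + i"] 2[of n "n + i"] by simp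
    moreover have "strict_mono (\<lambda>i. \<phi> (n + i))"
      using \<phi>(1) by (simp add: strict_mono_def)
    ultimately show ?thesis using that[of "\<lambda>i. \<phi> (n + i)"] by simp
  qed
qed

lemma is_submonoid_hull: "is_submonoid (is_submonoid hull G)"
  by (rule hull_in) (auto simp: is_submonoid_def)

lemma hull_insert_submonoid:
  "is_submonoid hull (insert g G) = {s + nmul c g | s c. s \<in> is_submonoid hull G}" (is "?L = ?R")
proof
  have H: "is_submonoid (is_submonoid hull G)" by (rule is_submonoid_hull)
  show "?L \<subseteq> ?R"
  proof (rule hull_minimal)
    have "x \<in> ?R" if "x \<in> G" for x
    proof -
      have "x = x + nmul 0 g" by simp
      thus ?thesis using hull_inc[OF that, of is_submonoid] by blast
    qed
    moreover have "g \<in> ?R"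
    proof -
      have "g = 0 + nmul 1 g" by simp
      thus ?thesis using is_submonoidD[OF H] by blast
    qed
    ultimately show "insert g G \<subseteq> ?R" by blast
    show "is_submonoid ?R"
    proof (rule is_submonoidI)
      have "0 = 0 + nmul 0 g" by simp
      thus "0 \<in> ?R" using is_submonoidD[OF H] by blast
    next
      fix x y assume "x \<in> ?R" "y \<in> ?R"
      then obtain s c t d where "s \<in> is_submonoid hull G" "x = s + nmul c g"
        "t \<in> is_submonoid hull G" "y = t + nmul d g" by auto
      moreover from this have "x + y = (s + t) + nmul (c + d) g" by (simp add: nmul_add add_ac)
      ultimately show "x + y \<in> ?R" using is_submonoidD[OF H] by blast
    qed
  qed
  have L: "is_submonoid ?L" by (rule is_submonoid_hull)
  have "nmul c g \<in> ?L" for c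
    by (induction c) (use is_submonoidD[OF L] hull_inc[of g "insert g G"] in auto)
  moreover have "is_submonoid hull G \<subseteq> ?L" by (rule hull_mono) auto
  ultimately show "?R \<subseteq> ?L" using is_submonoidD[OF L] by blast
qed

text \<open>
  Adding a generator \<open>g\<close> to \<open>G\<close> changes elements \<open>s\<close> to \<open>s + c g\<close>.  First thin out the sequence so that the
  parts \<open>s\<close> increase, then so that the numbers \<open>c\<close> do.
\<close>
lemma dickson_finitely_generated:
  fixes G :: "(nat \<times> nat) set"
  assumes "finite G"
  shows "dickson (is_submonoid hull G)"
  using assms
proof induction
  case empty
  have "is_submonoid hull {} = {0 :: nat \<times> nat}"
    by (rule hull_unique) (auto simp: is_submonoid_def)
  thus ?case
    by (auto simp: dickson_def image_subset_iff intro!: exI[of _ id] strict_mono_id)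
next
  case (insert g G)
  let ?H = "is_submonoid hull G"
  show ?case
    unfolding dickson_def
  proof (intro allI impI)
    fix f :: "nat \<Rightarrow> nat \<times> nat"
    assume "range f \<subseteq> is_submonoid hull (insert g G)"
    hence "\<forall>n. \<exists>s c. s \<in> ?H \<and> f n = s + nmul c g"
      unfolding hull_insert_submonoid by blast
    then obtain s c where f: "\<And>n. s n \<in> ?H" "\<And>n. f n = s n + nmul (c n) g" by metis
    obtain \<phi> :: "nat \<Rightarrow> nat" where \<phi>: "strict_mono \<phi>" "\<And>i j. i < j \<Longrightarrow> \<exists>t\<in>?H. s (\<phi> j) = s (\<phi> i) + t"
      using insert.IH[unfolded dickson_def, rule_format, of s] f(1) by blast
    obtain \<psi> :: "nat \<Rightarrow> nat" where \<psi>: "strict_mono \<psi>" "\<And>i j. i \<le> j \<Longrightarrow> c (\<phi> (\<psi> i)) \<le> c (\<phi> (\<psi> j))"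
      using nondecreasing_subseq[of "\<lambda>n. c (\<phi> n)"] by blast
    show "\<exists>\<phi> :: nat \<Rightarrow> nat. strict_mono \<phi> \<and>
      (\<forall>i j. i < j \<longrightarrow> (\<exists>t\<in>is_submonoid hull (insert g G). f (\<phi> j) = f (\<phi> i) + t))"
    proof (intro exI[of _ "\<phi> \<circ> \<psi>"] conjI allI impI)
      show "strict_mono (\<phi> \<circ> \<psi>)" by (rule strict_mono_o[OF \<phi>(1) \<psi>(1)])
      fix i j :: nat assume "i < j"
      then obtain t where t: "t \<in> ?H" "s (\<phi> (\<psi> j)) = s (\<phi> (\<psi> i)) + t"
        using \<phi>(2) strict_monoD[OF \<psi>(1)] by blast
      define d where "d = c (\<phi> (\<psi> j)) - c (\<phi> (\<psi> i))"
      have d: "c (\<phi> (\<psi> j)) = c (\<phi> (\<psi> i)) + d" using \<psi>(2)[of i j] \<open>i < j\<close> by (simp add: d_def)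
      have "f (\<phi> (\<psi> j)) = f (\<phi> (\<psi> i)) + (t + nmul d g)"
        by (simp add: f(2) t(2) d nmul_add add_ac)
      thus "\<exists>t\<in>is_submonoid hull (insert g G). f ((\<phi> \<circ> \<psi>) j) = f ((\<phi> \<circ> \<psi>) i) + t"
        using t(1) unfolding hull_insert_submonoid o_apply by blast
    qed
  qed
qed

text \<open>
  If no finite subset of \<open>E\<close> generates \<open>E\<close>, then choosing again and again an element not covered by the
  previous ones produces a sequence in which no element divides a later one.
\<close>
lemma dickson_finite_basis:
  assumes S: "dickson S" and E: "E \<subseteq> S"
  shows "\<exists>F. finite F \<and> F \<subseteq> E \<and> (\<forall>e\<in>E. \<exists>f\<in>F. \<exists>t\<in>S. e = f + t)"
proof (rule ccontr)
  assume no: "\<not> ?thesis"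
  have "\<exists>e. e \<in> E \<and> (\<forall>f\<in>F. \<forall>t\<in>S. e \<noteq> f + t)" if F: "finite F" "F \<subseteq> E" for F
  proof (rule ccontr)
    assume "\<nexists>e. e \<in> E \<and> (\<forall>f\<in>F. \<forall>t\<in>S. e \<noteq> f + t)"
    hence "\<forall>e\<in>E. \<exists>f\<in>F. \<exists>t\<in>S. e = f + t" by metis
    with F no show False by (metis (no_types, lifting))
  qed
  hence "\<forall>F\<in>{F. finite F \<and> F \<subseteq> E}. \<exists>e. e \<in> E \<and> (\<forall>f\<in>F. \<forall>t\<in>S. e \<noteq> f + t)" by blast
  from bchoice[OF this] obtain h where
    h: "\<forall>F\<in>{F. finite F \<and> F \<subseteq> E}. h F \<in> E \<and> (\<forall>f\<in>F. \<forall>t\<in>S. h F \<noteq> f + t)" ..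
  define A where "A = rec_nat {} (\<lambda>_ F. insert (h F) F)"
  have A_simps: "A 0 = {}" "A (Suc n) = insert (h (A n)) (A n)" for n
    by (simp_all add: A_def)
  have A: "A n \<in> {F. finite F \<and> F \<subseteq> E}" for n
  proof (induction n)
    case (Suc n)
    have "h (A n) \<in> E" using h Suc.IH by blast
    thus ?case using Suc.IH by (simp add: A_simps)
  qed (simp add: A_simps)
  have mono: "h (A i) \<in> A j" if "i < j" for i j
    using that by (induction j) (auto simp: A_simps less_Suc_eq)
  have "h (A n) \<in> S" for n using h A[of n] E by blast
  hence "range (\<lambda>n. h (A n)) \<subseteq> S" by blast
  from S[unfolded dickson_def, rule_format, OF this] obtain \<phi> :: "nat \<Rightarrow> nat" where \<phi>: "strict_mono \<phi>"
    "\<forall>i j. i < j \<longrightarrow> (\<exists>t\<in>S. h (A (\<phi> j)) = h (A (\<phi> i)) + t)" by blast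
  have lt: "\<phi> 0 < \<phi> 1" using strict_monoD[OF \<phi>(1)] by simp
  obtain t where t: "t \<in> S" "h (A (\<phi> 1)) = h (A (\<phi> 0)) + t" using \<phi>(2) zero_less_one by blast
  show False using h A[of "\<phi> 1"] mono[OF lt] t by blast
qed

text \<open>
  Choose elements of the ideal \<open>I\<close> whose leading exponents generate all leading exponents of \<open>I\<close>.  Subtracting a
  monomial multiple of one of them lowers the leading exponent of any element of \<open>I\<close>, so these elements
  generate \<open>I\<close>.
\<close>
lemma noetherian_semigroup_ring:
  assumes S: "is_submonoid S" and dick: "dickson S"
  shows "noetherian_ring (semigroup_ring S :: (nat \<times> nat \<Rightarrow>\<^sub>0 'k::field) ring)"
proof -
  let ?R = "semigroup_ring S :: (nat \<times> nat \<Rightarrow>\<^sub>0 'k) ring"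
  interpret R: cring ?R by (rule cring_semigroup_ring[OF S])
  show ?thesis
  proof (rule R.noetherian_ringI)
    fix I assume I: "ideal I ?R"
    interpret I: ideal I ?R by fact
    \<comment> \<open>\<open>?lead s p\<close>: the leading exponent of \<open>p \<in> I\<close> is \<open>s\<close>.\<close>
    let ?lead = "\<lambda>s p. p \<in> I \<and> s \<in> keys p \<and> (\<forall>t\<in>keys p. weight t \<le> weight s)"
    define E where "E = {s. \<exists>p. ?lead s p}"
    have "E \<subseteq> S"
    proof
      fix s assume "s \<in> E"
      then obtain p where "p \<in> I" "s \<in> keys p" unfolding E_def by blast
      thus "s \<in> S" using I.Icarr[of p] by auto
    qed
    from dickson_finite_basis[OF dick this] obtain F
      where F: "finite F" "F \<subseteq> E" "\<forall>e\<in>E. \<exists>f\<in>F. \<exists>t\<in>S. e = f + t" by (elim exE conjE)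
    have "\<forall>s\<in>F. \<exists>p. ?lead s p" using F(2) unfolding E_def by blast
    from bchoice[OF this] obtain g where g: "\<And>s. s \<in> F \<Longrightarrow> ?lead s (g s)" by blast
    let ?J = "Idl\<^bsub>?R\<^esub> (g ` F)"
    have gI: "g ` F \<subseteq> I" using g by blast
    have gR: "g ` F \<subseteq> carrier ?R" using gI I.Icarr by blast
    interpret J: ideal ?J ?R by (rule R.genideal_ideal[OF gR])
    have "p \<in> ?J" if "p \<in> I" "\<forall>t\<in>keys p. weight t < n" for p n
      using that
    proof (induction n arbitrary: p)
      case 0
      hence "p = 0" by (metis keys_eq_empty less_nat_zero_code all_not_in_conv)
      thus ?case using J.zero_closed by simp
    next
      case (Suc n)
      show ?case
      proof (cases "\<exists>s\<in>keys p. weight s = n")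
        case False
        thus ?thesis using Suc by (metis less_SucE)
      next
        case True
        then obtain s where s: "s \<in> keys p" "weight s = n" by blast
        hence lead: "?lead s p" using Suc.prems by auto
        hence "s \<in> E" unfolding E_def by blast
        then obtain f t where ft: "f \<in> F" "t \<in> S" "s = f + t" using F(3) by blast
        define c where "c = lookup p s / lookup (g f) f"
        have gf: "?lead f (g f)" using g ft by blast
        have c: "c * lookup (g f) f = lookup p s"
          using gf by (simp add: c_def in_keys_iff)
        \<comment> \<open>The product \<open>q\<close> of \<open>m\<close> with the generator \<open>g f\<close> cancels the leading term of \<open>p\<close>.\<close>
        define m where "m = single t (- c)"
        define q where "q = m * g f"
        have m: "single t c \<in> carrier ?R" "m \<in> carrier ?R" using ft(2) by (auto simp: m_def)
        have "q \<in> I" using I.I_l_closed[of "g f" m] gf m by (simp add: q_def)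
        hence pq: "p + q \<in> I" using I.a_closed[of p q] Suc.prems by simp
        have "lookup q (t + f) = lookup m t * lookup (g f) f"
          unfolding q_def by (rule lookup_mult_leading) (use gf in \<open>auto simp: m_def split: if_splits\<close>)
        hence qs: "lookup q s = - lookup p s" using c by (simp add: ft(3) add.commute m_def)
        have "weight u \<le> n" if u: "u \<in> keys q" for u
        proof -
          obtain a b where ab: "a \<in> keys m" "b \<in> keys (g f)" "u = a + b"
            using keys_mult[of m "g f"] u unfolding q_def by blast
          have "a = t" using ab(1) by (auto simp: m_def split: if_splits)
          thus ?thesis using gf ab(2,3) s(2) ft(3) by (auto simp: weight_add)
        qed
        moreover have "weight u \<le> n" if "u \<in> keys p" for u using lead that s(2) by auto
        ultimately have le: "weight u \<le> n" if "u \<in> keys (p + q)" for u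
          using that keys_add[of p q] by blast
        have "weight u < n" if u: "u \<in> keys (p + q)" for u
        proof -
          have "u \<noteq> s" using u qs by (auto simp: in_keys_iff lookup_add)
          hence "weight u \<noteq> n" using s(2) injD[OF inj_weight] by blast
          thus ?thesis using le[OF u] by simp
        qed
        hence "p + q \<in> ?J" using Suc.IH[OF pq] by blast
        moreover have "single t c * g f \<in> ?J"
          using J.I_l_closed[of "g f" "single t c"] R.genideal_self[OF gR] ft(1) m by auto
        ultimately have "(p + q) + single t c * g f \<in> ?J" using J.a_closed by fastforce
        moreover have "q = - (single t c * g f)" by (simp add: q_def m_def single_uminus)
        ultimately show ?thesis by simp
      qed
    qed note * = this
    have "p \<in> ?J" if "p \<in> I" for p
    proof (rule *[OF that, of "Suc (Max (weight ` keys p))"])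
      show "\<forall>t\<in>keys p. weight t < Suc (Max (weight ` keys p))" by (simp add: le_imp_less_Suc)
    qed
    hence "I = ?J" using R.genideal_minimal[OF I gI] by blast
    thus "\<exists>A\<subseteq>carrier ?R. finite A \<and> I = Idl\<^bsub>?R\<^esub> A" using gR F(1) by blast
  qed
qed

section \<open>The dimension bound\<close>

lemma keys_power_subset: "is_submonoid S \<Longrightarrow> keys p \<subseteq> S \<Longrightarrow> keys (p ^ n) \<subseteq> S"
  by (induction n) (auto simp: is_submonoid_def keys_mult_subset)

lemma keys_sum_subset: "(\<And>i. i \<in> I \<Longrightarrow> keys (f i) \<subseteq> S) \<Longrightarrow> keys (sum f I) \<subseteq> S"
  by (induction I rule: infinite_finite_induct) (auto simp: keys_add_subset)

lemma vector_space_poly: "vector_space (\<lambda>c (p :: nat \<times> nat \<Rightarrow>\<^sub>0 'k::field). single 0 c * p)"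
  by unfold_locales (simp_all add: distrib_left distrib_right single_add mult_single flip: mult.assoc)

lemma poly_eq_sum_single: "(p :: 'a \<Rightarrow>\<^sub>0 'b::comm_monoid_add) = (\<Sum>s\<in>keys p. single s (lookup p s))"
proof (rule poly_mapping_eqI)
  fix t
  have "lookup (\<Sum>s\<in>keys p. single s (lookup p s)) t = (\<Sum>s\<in>keys p. if s = t then lookup p s else 0)"
    unfolding lookup_sum by (intro sum.cong refl) (auto simp: lookup_single when_def)
  thus "lookup p t = lookup (\<Sum>s\<in>keys p. single s (lookup p s)) t"
    by (simp add: in_keys_iff)
qed

text \<open>
  Polynomials supported on \<open>B\<close> form a \<open>K\<close>-space of dimension at most \<open>card B\<close>.  The
  relation is indexed by \<open>I\<close> and not by the set of polynomials, so that a repetition in the family counts as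
  a relation as well.
\<close>
lemma linear_relation:
  fixes F :: "'i \<Rightarrow> (nat \<times> nat \<Rightarrow>\<^sub>0 'k::field)"
  assumes I: "finite I" and B: "finite B" "\<And>i. i \<in> I \<Longrightarrow> keys (F i) \<subseteq> B" "card B < card I"
  shows "\<exists>c. (\<Sum>i\<in>I. single 0 (c i) * F i) = 0 \<and> (\<exists>i\<in>I. c i \<noteq> 0)"
proof (cases "inj_on F I")
  case True
  interpret V: vector_space "\<lambda>c (p :: nat \<times> nat \<Rightarrow>\<^sub>0 'k). single 0 c * p"
    by (rule vector_space_poly)
  let ?X = "(\<lambda>s. single s 1) ` B :: (nat \<times> nat \<Rightarrow>\<^sub>0 'k) set"
  have "F i \<in> V.span ?X" if "i \<in> I" for i
  proof -
    have "single s (lookup (F i) s) \<in> V.span ?X" if "s \<in> keys (F i)" for s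
    proof -
      have "single s 1 \<in> V.span ?X" using that B(2)[OF \<open>i \<in> I\<close>] by (intro V.span_base) blast
      from V.span_scale[OF this, of "lookup (F i) s"] show ?thesis by (simp add: mult_single)
    qed
    hence "(\<Sum>s\<in>keys (F i). single s (lookup (F i) s)) \<in> V.span ?X" by (rule V.span_sum)
    thus ?thesis using poly_eq_sum_single[of "F i"] by simp
  qed
  hence span: "F ` I \<subseteq> V.span ?X" by blast
  have "V.dependent (F ` I)"
  proof (rule ccontr)
    assume "\<not> V.dependent (F ` I)"
    hence "card (F ` I) \<le> card ?X"
      using V.independent_span_bound[of ?X "F ` I"] span B(1) by blast
    thus False using B(3) card_image_le[OF B(1), of "\<lambda>s. single s 1 :: nat \<times> nat \<Rightarrow>\<^sub>0 'k"] card_image[OF True] by linarith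
  qed
  then obtain u where u: "\<exists>v\<in>F ` I. u v \<noteq> 0" "(\<Sum>v\<in>F ` I. single 0 (u v) * v) = 0"
    using V.dependent_finite[of "F ` I"] I by blast
  have "(\<Sum>i\<in>I. single 0 (u (F i)) * F i) = 0"
    using u(2) by (simp add: sum.reindex[OF True])
  thus ?thesis using u(1) by (intro exI[of _ "\<lambda>i. u (F i)"]) blast
next
  case False
  then obtain i j where ij: "i \<in> I" "j \<in> I" "i \<noteq> j" "F i = F j" by (auto simp: inj_on_def)
  define c where "c = (\<lambda>x. if x = i then 1 else if x = j then - 1 else (0 :: 'k))"
  have "(\<Sum>x\<in>I. single 0 (c x) * F x) = (\<Sum>x\<in>{i, j}. single 0 (c x) * F x)"
    using ij I by (intro sum.mono_neutral_right) (auto simp: c_def)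
  also have "\<dots> = 0" using ij by (simp add: c_def single_uminus)
  finally show ?thesis using ij(1) by (intro exI[of _ c]) (auto simp: c_def)
qed

text \<open>
  One step of an algebraic independence proof: reducing \<open>u\<^sub>0 + f u\<^sub>1 + \<dots> \<in> P\<close> modulo \<open>P'\<close> leaves \<open>u\<^sub>0\<close>, which
  therefore vanishes; the remaining sum is divisible by \<open>f\<close>, and the factor \<open>f\<close> can be cancelled modulo the
  prime \<open>P\<close>.
\<close>
lemma coefficients_vanish:
  fixes f :: "nat \<times> nat \<Rightarrow>\<^sub>0 'k::field" and S defines "R \<equiv> semigroup_ring S"
  assumes S: "is_submonoid S" and P: "primeideal P R" and P': "ideal P' R" "P \<subseteq> P'"
    and f: "f \<in> P'" "f \<notin> P"
    and V: "V \<subseteq> carrier R" "V \<inter> P' \<subseteq> {0}"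
    and u: "\<And>i. i < N \<Longrightarrow> u i \<in> V" "(\<Sum>i<N. f ^ i * u i) \<in> P"
  shows "\<forall>i<N. u i = 0"
  using u
proof (induction N arbitrary: u)
  case (Suc N)
  interpret P: primeideal P R by fact
  interpret P': ideal P' R by fact
  define r where "r = (\<Sum>i<N. f ^ i * u (Suc i))"
  have fS: "keys f \<subseteq> S" using P'.Icarr[OF f(1)] by (simp add: R_def)
  have uS: "keys (u i) \<subseteq> S" if "i < Suc N" for i
    using Suc.prems(1)[OF that] V(1) by (auto simp: R_def)
  have rS: "keys r \<subseteq> S"
    unfolding r_def by (intro keys_sum_subset keys_mult_subset[OF S] keys_power_subset[OF S] fS uS) auto
  have total: "(\<Sum>i<Suc N. f ^ i * u i) = u 0 + f * r"
    by (simp add: sum.lessThan_Suc_shift r_def sum_distrib_left mult.assoc del: sum.lessThan_Suc)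
  have "f * (- r) \<in> P'"
    using P'.I_r_closed[OF f(1), of "- r"] rS by (simp add: R_def)
  moreover have "u 0 + f * r \<in> P'" using Suc.prems(2) P'(2) unfolding total by blast
  ultimately have "(u 0 + f * r) \<oplus>\<^bsub>R\<^esub> f * (- r) \<in> P'" by (intro P'.a_closed)
  hence "u 0 \<in> P'" by (simp add: R_def)
  hence u0: "u 0 = 0" using Suc.prems(1)[of 0] V(2) by blast
  have "f * r \<in> P" using Suc.prems(2) unfolding total u0 by simp
  hence "r \<in> P" using P.I_prime[of f r] fS rS f(2) by (simp add: R_def)
  hence "\<forall>i<N. u (Suc i) = 0"
    by (intro Suc.IH[of "\<lambda>i. u (Suc i)"]) (auto simp: r_def intro: Suc.prems(1))
  thus ?case using u0 by (auto simp: less_Suc_eq_0_disj)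
qed simp

definition box :: "nat \<Rightarrow> (nat \<times> nat) set" where "box n = {..n} \<times> {..n}"

lemma box_simps: "finite (box n)" "card (box n) = (n + 1)\<^sup>2"
  by (simp_all add: box_def power2_eq_square)

lemma keys_mult_box:
  assumes "keys p \<subseteq> box m" "keys q \<subseteq> box n"
  shows "keys (p * q) \<subseteq> box (m + n)"
proof
  fix s assume "s \<in> keys (p * q)"
  then obtain a b where "a \<in> keys p" "b \<in> keys q" "s = a + b" using keys_mult[of p q] by blast
  hence "a \<in> box m" "b \<in> box n" using assms by auto
  thus "s \<in> box (m + n)" using \<open>s = a + b\<close> by (auto simp: box_def)
qed

lemma box_mono: "m \<le> n \<Longrightarrow> box m \<subseteq> box n"
  by (auto simp: box_def)

lemma keys_power_box: "keys p \<subseteq> box m \<Longrightarrow> keys (p ^ i) \<subseteq> box (i * m)"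
proof (induction i)
  case 0
  show ?case by (simp add: box_def zero_prod_def)
next
  case (Suc i)
  thus ?case using keys_mult_box[of p m "p ^ i" "i * m"] by simp
qed

lemma ex_box: "\<exists>E. keys p \<subseteq> box E"
proof -
  have "finite (fst ` keys p \<union> snd ` keys p)" by simp
  then obtain E where "\<forall>x\<in>fst ` keys p \<union> snd ` keys p. x \<le> E"
    using finite_nat_set_iff_bounded_le by blast
  thus ?thesis by (intro exI[of _ E]) (force simp: box_def)
qed

text \<open>
  The last hypothesis says that \<open>z\<close> is transcendental over \<open>K\<close> modulo \<open>P2\<close>.  Elements \<open>x \<in> P1 - P0\<close> and
  \<open>y \<in> P2 - P1\<close> give \<open>N\<^sup>3\<close> products \<open>x\<^sup>i y\<^sup>j z\<^sup>k\<close> in a space whose dimension grows only quadratically in \<open>N\<close>.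
  In a linear relation between them, three applications of cancellation, along \<open>P0\<close>, \<open>P1\<close> and \<open>P2\<close>, remove
  first \<open>x\<close>, then \<open>y\<close>, then \<open>z\<close> and kill all coefficients.
\<close>
lemma no_transcendental_over_prime_chain:
  fixes z :: "nat \<times> nat \<Rightarrow>\<^sub>0 'k::field" and S defines "R \<equiv> semigroup_ring S"
  assumes S: "is_submonoid S"
    and P: "primeideal P0 R" "primeideal P1 R" "primeideal P2 R" "P0 \<subset> P1" "P1 \<subset> P2"
    and z: "z \<in> carrier R"
      "\<And>N c. (\<Sum>k<N. single 0 (c k) * z ^ k) \<in> P2 \<Longrightarrow> \<forall>k<N. c k = 0"
  shows False
proof -
  interpret P0: primeideal P0 R by fact
  interpret P1: primeideal P1 R by fact
  interpret P2: primeideal P2 R by fact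
  obtain x where x: "x \<in> P1" "x \<notin> P0" using P(4) by blast
  obtain y where y: "y \<in> P2" "y \<notin> P1" using P(5) by blast
  obtain E1 E2 E3 where E: "keys x \<subseteq> box E1" "keys y \<subseteq> box E2" "keys z \<subseteq> box E3"
    using ex_box by metis
  define E where "E = Suc (E1 + E2 + E3)"
  have xyz: "keys x \<subseteq> box E" "keys y \<subseteq> box E" "keys z \<subseteq> box E"
    using E box_mono[of _ E] unfolding E_def by (meson subset_trans le_add1 le_add2 le_SucI trans_le_add1)+
  \<comment> \<open>The products have exponents up to \<open>3 N E\<close>, and \<open>(3 N E + 1)\<^sup>2 \<le> 16 E\<^sup>2 N\<^sup>2 < N\<^sup>3\<close> as soon as \<open>N > 16 E\<^sup>2\<close>.\<close>
  define N where "N = Suc (16 * E\<^sup>2)"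
  define I where "I = {..<N} \<times> {..<N} \<times> {..<N}"
  define F where "F = (\<lambda>(i, j, k). x ^ i * (y ^ j * z ^ k))"
  have keys_F: "keys (F w) \<subseteq> box (3 * (N * E))" if wI: "w \<in> I" for w
  proof -
    obtain i j k where w: "w = (i, j, k)" "i < N" "j < N" "k < N" using wI by (auto simp: I_def)
    have "keys (F w) \<subseteq> box (i * E + (j * E + k * E))"
      unfolding w(1) F_def prod.case by (intro keys_mult_box keys_power_box xyz)
    also have "i * E + (j * E + k * E) \<le> N * E + (N * E + N * E)"
      using w by (intro add_mono mult_right_mono) auto
    hence "box (i * E + (j * E + k * E)) \<subseteq> box (3 * (N * E))"
      by (intro box_mono) simp
    finally show ?thesis .
  qed
  have card: "card (box (3 * (N * E))) < card I"
  proof -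
    have "1 \<le> N * E" by (simp add: N_def E_def)
    hence "(3 * (N * E) + 1)\<^sup>2 \<le> (4 * (N * E))\<^sup>2" by (intro power_mono) auto
    also have "\<dots> = 16 * E\<^sup>2 * N\<^sup>2" by (simp add: power2_eq_square)
    also have "\<dots> < N * N\<^sup>2" by (simp add: N_def)
    finally show ?thesis by (simp add: I_def box_simps power2_eq_square)
  qed
  have "finite I" by (simp add: I_def)
  from linear_relation[of I "box (3 * (N * E))" F, OF this box_simps(1) keys_F card]
  obtain c where c: "(\<Sum>w\<in>I. single 0 (c w) * F w) = 0" "\<exists>w\<in>I. c w \<noteq> 0" by blast
  define v where "v = (\<lambda>i j. \<Sum>k<N. single 0 (c (i, j, k)) * z ^ k)"
  define u where "u = (\<lambda>i. \<Sum>j<N. y ^ j * v i j)"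
  \<comment> \<open>\<open>V\<close> holds polynomials in \<open>z\<close>, and \<open>U\<close> polynomials in \<open>y\<close> and \<open>z\<close>; they meet \<open>P2\<close> and \<open>P1\<close>, respectively,
    only in zero, as the cancellation of \<open>y\<close> and \<open>x\<close> requires.\<close>
  define V where "V = {\<Sum>k<N. single 0 (d k) * z ^ k | d. True}"
  define U where "U = {\<Sum>j<N. y ^ j * w j | w. \<forall>j. w j \<in> V}"
  have zS: "keys z \<subseteq> S" using z(1) by (simp add: R_def)
  have yS: "keys y \<subseteq> S" using P2.Icarr[OF y(1)] by (simp add: R_def)
  have S0: "keys (single 0 a) \<subseteq> S" for a :: 'k using S by (simp add: is_submonoid_def)
  have VR: "V \<subseteq> carrier R"
  proof
    fix p assume "p \<in> V"
    then obtain d where d: "p = (\<Sum>k<N. single 0 (d k) * z ^ k)" unfolding V_def by blast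
    have "keys p \<subseteq> S"
      unfolding d by (intro keys_sum_subset keys_mult_subset[OF S] keys_power_subset[OF S] zS S0)
    thus "p \<in> carrier R" by (simp add: R_def)
  qed
  have UR: "U \<subseteq> carrier R"
  proof
    fix p assume "p \<in> U"
    then obtain w where w: "\<And>j. w j \<in> V" "p = (\<Sum>j<N. y ^ j * w j)" unfolding U_def by blast
    have "keys (w j) \<subseteq> S" for j using w(1)[of j] VR by (auto simp: R_def)
    hence "keys p \<subseteq> S"
      unfolding w(2) by (intro keys_sum_subset keys_mult_subset[OF S] keys_power_subset[OF S] yS)
    thus "p \<in> carrier R" by (simp add: R_def)
  qed
  have VP: "V \<inter> P2 \<subseteq> {0}"
  proof
    fix p assume "p \<in> V \<inter> P2"
    then obtain d where d: "p = (\<Sum>k<N. single 0 (d k) * z ^ k)" "p \<in> P2" unfolding V_def by blast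
    hence "\<forall>k<N. d k = 0" using z(2) by blast
    thus "p \<in> {0}" unfolding d(1) by simp
  qed
  have coeffs: "\<forall>j<N. w j = 0" if "\<And>j. w j \<in> V" "(\<Sum>j<N. y ^ j * w j) \<in> P1" for w
    by (rule coefficients_vanish[where 'k = 'k, OF S, folded R_def, OF P(2) P2.is_ideal _ y VR VP])
      (use that P(5) in auto)
  have UP: "U \<inter> P1 \<subseteq> {0}"
  proof
    fix p assume "p \<in> U \<inter> P1"
    then obtain w where w: "\<And>j. w j \<in> V" "p = (\<Sum>j<N. y ^ j * w j)" "p \<in> P1" unfolding U_def by blast
    hence "\<forall>j<N. w j = 0" using coeffs by blast
    thus "p \<in> {0}" unfolding w(2) by simp
  qed
  have vV: "v i j \<in> V" for i j unfolding v_def V_def by (rule CollectI, intro exI[of _ "\<lambda>k. c (i, j, k)"]) simp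
  have uU: "u i \<in> U" for i unfolding u_def U_def by (rule CollectI, intro exI[of _ "v i"]) (simp add: vV)
  have "(\<Sum>i<N. x ^ i * u i) = (\<Sum>w\<in>I. single 0 (c w) * F w)"
    unfolding I_def F_def u_def v_def
    by (simp add: sum_distrib_left sum.cartesian_product mult_ac case_prod_unfold)
  also have "\<dots> \<in> P0" using c(1) additive_subgroup.zero_closed[OF P0.additive_subgroup_axioms] by (simp add: R_def)
  finally have "(\<Sum>i<N. x ^ i * u i) \<in> P0" .
  hence u0: "\<forall>i<N. u i = 0"
    by (intro coefficients_vanish[where 'k = 'k, OF S, folded R_def, OF P(1) P1.is_ideal _ x UR UP])
      (use P(4) uU in auto)
  have zero_mem: "0 \<in> P1" "0 \<in> P2"
    using additive_subgroup.zero_closed[OF P1.additive_subgroup_axioms]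
      additive_subgroup.zero_closed[OF P2.additive_subgroup_axioms] by (simp_all add: R_def)
  have v0: "v i j = 0" if ij: "i < N" "j < N" for i j
  proof -
    have "u i \<in> P1" using u0 ij(1) zero_mem(1) by simp
    hence "\<forall>j<N. v i j = 0" using coeffs[of "v i", OF vV] unfolding u_def by blast
    thus ?thesis using ij(2) by blast
  qed
  have "c (i, j, k) = 0" if ijk: "i < N" "j < N" "k < N" for i j k
  proof -
    have "(\<Sum>k<N. single 0 (c (i, j, k)) * z ^ k) \<in> P2"
      using v0[OF ijk(1,2)] zero_mem(2) unfolding v_def by simp
    from z(2)[OF this] show ?thesis using ijk(3) by blast
  qed
  thus False using c(2) by (auto simp: I_def)
qed

text \<open>
  A relation of \<open>z\<close> modulo \<open>P\<close> is cancelled power by power: its constant term lies in the larger prime \<open>Q\<close>,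
  which contains no nonzero constant.
\<close>
lemma transcendental_outside_prime:
  fixes z :: "nat \<times> nat \<Rightarrow>\<^sub>0 'k::field" and S defines "R \<equiv> semigroup_ring S"
  assumes S: "is_submonoid S" and P: "primeideal P R" "primeideal Q R" "P \<subseteq> Q"
    and z: "z \<in> Q" "z \<notin> P" and c: "(\<Sum>k<N. single 0 (c k) * z ^ k) \<in> P"
  shows "\<forall>k<N. c k = 0"
proof -
  interpret Q: primeideal Q R by fact
  have S0: "keys (single 0 a) \<subseteq> S" for a :: 'k using S by (simp add: is_submonoid_def)
  let ?V = "range (single 0) :: (nat \<times> nat \<Rightarrow>\<^sub>0 'k) set"
  have V: "?V \<subseteq> carrier R" using S0 unfolding R_def semigroup_ring_simps by blast
  have "?V \<inter> Q \<subseteq> {0}"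
  proof
    fix p assume "p \<in> ?V \<inter> Q"
    then obtain a where a: "p = single 0 a" "single 0 a \<in> Q" by blast
    show "p \<in> {0}"
    proof (rule ccontr)
      assume "p \<notin> {0}"
      hence "a \<noteq> 0" using a(1) by auto
      have "single 0 (inverse a) \<in> carrier R" using V by blast
      from Q.I_l_closed[OF a(2) this] have "\<one>\<^bsub>R\<^esub> \<in> Q"
        using \<open>a \<noteq> 0\<close> by (simp add: R_def mult_single)
      thus False using Q.one_imp_carrier Q.I_notcarr by blast
    qed
  qed
  moreover have "(\<Sum>k<N. z ^ k * single 0 (c k)) \<in> P" using c by (simp add: mult.commute)
  ultimately have "\<forall>k<N. single (0 :: nat \<times> nat) (c k) = 0"
    using coefficients_vanish[where 'k = 'k and u = "\<lambda>k. single 0 (c k)" and N = N, OF S, folded R_def,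
        OF P(1) Q.is_ideal P(3) z V] by blast
  thus ?thesis by (metis lookup_single_eq lookup_zero)
qed

section \<open>The Cohen-Macaulay criterion for two monomials\<close>

text \<open>
  The last assumption is the criterion for two-dimensional semigroup rings: a lattice point \<open>a\<close> with
  \<open>a + n1 \<in> S\<close> and \<open>a + n2 \<in> S\<close> belongs to \<open>S\<close>.  It is stated in terms of \<open>u = a + n1\<close> and \<open>v = a + n2\<close>, because
  \<open>a\<close> itself may have negative coordinates.
\<close>
locale axis_pair =
  fixes S :: "(nat \<times> nat) set" and n1 n2
  assumes S: "is_submonoid S" and n1_mem: "n1 \<in> S" and n2_mem: "n2 \<in> S" and n1_nz: "n1 \<noteq> 0" and n2_nz: "n2 \<noteq> 0"
    and gap: "\<And>u v. u \<in> S \<Longrightarrow> v \<in> S \<Longrightarrow> u + n2 = v + n1 \<Longrightarrow> \<exists>t\<in>S. u = t + n1"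
begin

text \<open>
  The largest \<open>e\<close> with \<open>deep e s\<close> plays the role of the degree of the monomial \<open>s\<close> in direction \<open>n1\<close>.  By the
  gap property, adding \<open>n2\<close> does not raise it.
\<close>
definition deep :: "nat \<Rightarrow> nat \<times> nat \<Rightarrow> bool" where
  "deep e s \<longleftrightarrow> (\<exists>t\<in>S. s = t + nmul e n1)"

lemma deep_add_n2:
  assumes "s \<in> S" "deep e (s + n2)"
  shows "deep e s"
  using assms
proof (induction e)
  case 0
  thus ?case by (auto simp: deep_def intro!: bexI[of _ s])
next
  case (Suc e)
  then obtain t where t: "t \<in> S" "s + n2 = t + nmul (Suc e) n1" by (auto simp: deep_def)
  have "t + n1 \<in> S" using S t(1) n1_mem by (simp add: is_submonoid_def)
  moreover have "s + n2 = (t + n1) + nmul e n1" using t(2) by (simp add: add_ac)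
  ultimately have "deep e s" using Suc unfolding deep_def by blast
  then obtain r where r: "r \<in> S" "s = r + nmul e n1" by (auto simp: deep_def)
  have "(r + n2) + nmul e n1 = (t + n1) + nmul e n1" using t(2) r(2) by (simp add: add_ac)
  hence "r + n2 = t + n1" by (rule add_right_imp_eq)
  then obtain q where "q \<in> S" "r = q + n1" using gap r(1) t(1) by blast
  thus ?case using r(2) by (auto simp: deep_def add_ac intro!: bexI[of _ q])
qed

lemma deep_add_nmul:
  assumes "s \<in> S" "deep e (s + nmul l n2)"
  shows "deep e s"
  using assms
proof (induction l arbitrary: s)
  case (Suc l)
  have "s + n2 \<in> S" using S Suc.prems(1) n2_mem by (simp add: is_submonoid_def)
  moreover have "deep e ((s + n2) + nmul l n2)" using Suc.prems(2) by (simp add: add_ac)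
  ultimately show ?case using Suc.IH deep_add_n2 Suc.prems(1) by blast
qed simp

lemma weight_n1: "weight n1 > 1"
proof -
  have "weight n1 \<noteq> weight 0" using n1_nz injD[OF inj_weight] by blast
  thus ?thesis using weight_pos[of n1] by (simp del: weight_pos)
qed

text \<open>
  Division with remainder by a polynomial \<open>f\<close> of degree \<open>e\<close> in the monomial at \<open>n1\<close>.  The exponents to
  be removed are those from which \<open>n1\<close> can be subtracted \<open>e\<close> times within \<open>S\<close>; removing the one of largest
  weight introduces only exponents of smaller weight.
\<close>
lemma division:
  fixes f p :: "nat \<times> nat \<Rightarrow>\<^sub>0 'k::field"
  assumes f: "keys f \<subseteq> {nmul k n1 | k. k \<le> e}" "lookup f (nmul e n1) \<noteq> 0"
    and p: "keys p \<subseteq> S"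
  shows "\<exists>h r. keys h \<subseteq> S \<and> keys r \<subseteq> S \<and> (\<forall>s\<in>keys r. \<not> deep e s) \<and> p = f * h + r"
proof -
  have nS: "nmul k n1 \<in> S" for k
    by (induction k) (use S n1_mem in \<open>auto simp: is_submonoid_def\<close>)
  have fS: "keys f \<subseteq> S" using f(1) nS by blast
  have fle: "weight u \<le> weight (nmul e n1)" if "u \<in> keys f" for u
  proof -
    obtain k where "k \<le> e" "u = nmul k n1" using f(1) \<open>u \<in> keys f\<close> by blast
    thus ?thesis using weight_n1 by (simp add: weight_nmul power_increasing)
  qed
  have "\<exists>h r. keys h \<subseteq> S \<and> keys r \<subseteq> S \<and> (\<forall>s\<in>keys r. \<not> deep e s) \<and> p = f * h + r"
    if "keys p \<subseteq> S" "\<forall>s\<in>keys p. deep e s \<longrightarrow> weight s < n" for p n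
    using that
  proof (induction n arbitrary: p)
    case 0
    thus ?case by (intro exI[of _ 0] exI[of _ p]) auto
  next
    case (Suc n)
    show ?case
    proof (cases "\<exists>s\<in>keys p. deep e s \<and> weight s = n")
      case False
      hence "\<forall>s\<in>keys p. deep e s \<longrightarrow> weight s < n" using Suc.prems(2) less_antisym by blast
      thus ?thesis using Suc.IH Suc.prems(1) by blast
    next
      case True
      then obtain s t where s: "s \<in> keys p" "weight s = n" and t: "t \<in> S" "s = nmul e n1 + t"
        by (auto simp: deep_def add.commute)
      define c where "c = lookup p s / lookup f (nmul e n1)"
      define q where "q = f * single t c"
      have "lookup q (nmul e n1 + t) = lookup f (nmul e n1) * lookup (single t c) t"
        unfolding q_def by (rule lookup_mult_leading) (use fle in \<open>auto split: if_splits\<close>)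
      hence qs: "lookup q s = lookup p s" using f(2) t(2) by (simp add: c_def)
      have qle: "weight u \<le> n" if u: "u \<in> keys q" for u
      proof -
        obtain a b where ab: "a \<in> keys f" "b \<in> keys (single t c)" "u = a + b"
          using keys_mult[of f "single t c"] u unfolding q_def by blast
        have "b = t" using ab(2) by (auto split: if_splits)
        hence "weight u = weight a * weight t" using ab(3) by (simp add: weight_add)
        also have "\<dots> \<le> weight (nmul e n1) * weight t" using fle[OF ab(1)] by (rule mult_le_mono1)
        finally show ?thesis using s(2) t(2) by (simp add: weight_add)
      qed
      have qS: "keys q \<subseteq> S"
        unfolding q_def by (rule keys_mult_subset[OF S fS]) (use t(1) in auto)
      have kpq: "keys (p - q) \<subseteq> keys p \<union> keys q" using keys_add[of p "- q"] by simp
      have "keys (p - q) \<subseteq> S" using kpq qS Suc.prems(1) by blast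
      moreover have "weight u < n" if u: "u \<in> keys (p - q)" "deep e u" for u
      proof -
        have "u \<noteq> s" using u(1) qs by (auto simp: in_keys_iff lookup_minus)
        hence "weight u \<noteq> n" using s(2) injD[OF inj_weight] by blast
        moreover have "weight u \<le> n"
          using kpq u qle[of u] Suc.prems(2) by (auto simp: less_Suc_eq_le)
        ultimately show ?thesis by simp
      qed
      ultimately obtain h r where hr: "keys h \<subseteq> S" "keys r \<subseteq> S" "\<forall>s\<in>keys r. \<not> deep e s" "p - q = f * h + r"
        using Suc.IH by blast
      have "p = f * (h + single t c) + r"
        using hr(4) by (simp add: q_def algebra_simps)
      moreover have "keys (h + single t c) \<subseteq> S"
        by (rule keys_add_subset[OF hr(1)]) (use t(1) in auto)
      ultimately show ?thesis using hr(2,3) by blast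
    qed
  qed note main = this
  show ?thesis
    by (rule main[OF p, of "Suc (Max (weight ` keys p))"]) (simp add: le_imp_less_Suc)
qed

text \<open>
  Divide \<open>p = f h + r\<close> and put \<open>q' = q - g h\<close>, so that \<open>g r = f q'\<close>.  The exponents of \<open>g r\<close> have degree below
  \<open>e\<close> in direction \<open>n1\<close>, as those of \<open>r\<close> do and \<open>g\<close> only adds multiples of \<open>n2\<close>; but if \<open>q' \<noteq> 0\<close>, the leading
  exponent of \<open>f q'\<close> has degree at least \<open>e\<close>.  Hence \<open>q' = 0\<close> and \<open>r = 0\<close>.
\<close>
lemma axis_polynomials_regular:
  fixes f g p q :: "nat \<times> nat \<Rightarrow>\<^sub>0 'k::field"
  assumes f: "f \<noteq> 0" "keys f \<subseteq> range (\<lambda>k. nmul k n1)"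
    and g: "g \<noteq> 0" "keys g \<subseteq> range (\<lambda>k. nmul k n2)"
    and pq: "keys p \<subseteq> S" "keys q \<subseteq> S" "g * p = f * q"
  shows "\<exists>h. keys h \<subseteq> S \<and> p = f * h"
proof -
  obtain s where s: "s \<in> keys f" "\<And>t. t \<in> keys f \<Longrightarrow> weight t \<le> weight s"
    using leading_exponent[OF f(1)] by blast
  then obtain e where e: "s = nmul e n1" using f(2) by blast
  have f': "keys f \<subseteq> {nmul k n1 | k. k \<le> e}" "lookup f (nmul e n1) \<noteq> 0"
  proof
    fix t assume t: "t \<in> keys f"
    then obtain k where k: "t = nmul k n1" using f(2) by blast
    hence "k \<le> e" using s(2)[OF t] weight_n1 e by (simp add: weight_nmul power_increasing_iff)
    thus "t \<in> {nmul k n1 | k. k \<le> e}" using k by blast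
  next
    show "lookup f (nmul e n1) \<noteq> 0" using s(1) e by (simp add: in_keys_iff)
  qed
  obtain h r where hr: "keys h \<subseteq> S" "keys r \<subseteq> S" "\<forall>s\<in>keys r. \<not> deep e s" "p = f * h + r"
    using division[OF f' pq(1)] by blast
  have n2S: "nmul k n2 \<in> S" for k
    by (induction k) (use S n2_mem in \<open>auto simp: is_submonoid_def\<close>)
  define q' where "q' = q - g * h"
  have "keys g \<subseteq> S" using g(2) n2S by blast
  hence "keys (g * h) \<subseteq> S" by (rule keys_mult_subset[OF S _ hr(1)])
  hence q'S: "keys q' \<subseteq> S" using keys_add[of q "- (g * h)"] pq(2) unfolding q'_def by auto
  have eq: "g * r = f * q'" using pq(3) unfolding hr(4) q'_def by (simp add: algebra_simps)
  have "q' = 0"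
  proof (rule ccontr)
    assume "q' \<noteq> 0"
    then obtain w where w: "w \<in> keys q'" "\<And>t. t \<in> keys q' \<Longrightarrow> weight t \<le> weight w"
      using leading_exponent by blast
    have "lookup (f * q') (nmul e n1 + w) = lookup f (nmul e n1) * lookup q' w"
      by (rule lookup_mult_leading) (use s w e in auto)
    hence "nmul e n1 + w \<in> keys (g * r)" using f'(2) w(1) unfolding eq by (simp add: in_keys_iff)
    then obtain a b where ab: "a \<in> keys g" "b \<in> keys r" "nmul e n1 + w = a + b"
      using keys_mult[of g r] by blast
    then obtain l where "a = nmul l n2" using g(2) by blast
    hence "b + nmul l n2 = w + nmul e n1" using ab(3) by (simp add: add.commute)
    hence "deep e (b + nmul l n2)" using w(1) q'S unfolding deep_def by auto
    hence "deep e b" using deep_add_nmul ab(2) hr(2) by blast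
    thus False using hr(3) ab(2) by blast
  qed
  hence "r = 0" using eq g(1) by (simp add: poly_mult_eq_0_iff)
  thus ?thesis using hr(1,4) by auto
qed

end

lemma axis_polynomial:
  fixes c :: "nat \<Rightarrow> 'k::field"
  assumes n: "n \<noteq> 0" and c: "k < N" "c k \<noteq> 0"
  defines "p \<equiv> (\<Sum>k<N. single 0 (c k) * single n 1 ^ k)"
  shows "p \<noteq> 0" "keys p \<subseteq> range (\<lambda>k. nmul k n)"
proof -
  have pow: "single n (1 :: 'k) ^ k = single (nmul k n) 1" for k
    by (induction k) (simp_all add: mult_single)
  have p: "p = (\<Sum>k<N. single (nmul k n) (c k))"
    by (simp add: p_def pow mult_single)
  show "keys p \<subseteq> range (\<lambda>k. nmul k n)"
    unfolding p by (rule keys_sum_subset) auto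
  have inj: "nmul i n = nmul j n \<longleftrightarrow> i = j" for i j
    using n by (cases n) (auto simp: nmul_def zero_prod_def)
  have "lookup p (nmul k n) = (\<Sum>i<N. if i = k then c i else 0)"
    unfolding p lookup_sum by (intro sum.cong refl) (auto simp: lookup_single inj when_def)
  also have "\<dots> = c k" using c(1) by simp
  finally show "p \<noteq> 0" using c(2) by auto
qed

context axis_pair
begin

lemma ex_axis_polynomial:
  fixes m :: "(nat \<times> nat \<Rightarrow>\<^sub>0 'k::field) set"
  assumes "n \<noteq> 0" "\<not> (\<forall>N c. (\<Sum>k<N. single 0 (c k) * single n 1 ^ k) \<in> m \<longrightarrow> (\<forall>k<N. c k = 0))"
  shows "\<exists>f\<in>m. f \<noteq> 0 \<and> keys f \<subseteq> range (\<lambda>k. nmul k n)"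
proof -
  obtain N c k where c: "(\<Sum>k<N. single 0 (c k) * single n 1 ^ k) \<in> m" "k < N" "c k \<noteq> (0 :: 'k)"
    using assms(2) by blast
  show ?thesis using c(1) axis_polynomial[where c = c and k = k and N = N, OF assms(1) c(2,3)] by blast
qed

text \<open>
  If \<open>m\<close> contains no nonzero polynomial in one of the two axis monomials, that monomial is transcendental
  modulo \<open>m\<close> and the dimension is at most 1, which the depth attains if \<open>m \<noteq> 0\<close>.  Otherwise two such polynomials show that the depth is at
  least 2, which the dimension never exceeds.
\<close>
lemma localization_cohen_macaulay:
  fixes m :: "(nat \<times> nat \<Rightarrow>\<^sub>0 'k::field) set"
  assumes N: "noetherian_ring (semigroup_ring S :: (nat \<times> nat \<Rightarrow>\<^sub>0 'k) ring)"
    and m: "maximalideal m (semigroup_ring S)"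
  shows "cohen_macaulay_local (localization (semigroup_ring S) m)"
proof -
  define R where "R = (semigroup_ring S :: (nat \<times> nat \<Rightarrow>\<^sub>0 'k) ring)"
  interpret R: cring R unfolding R_def by (rule cring_semigroup_ring[OF S])
  interpret prime_localization m R
    unfolding prime_localization_def by (rule R.maximalideal_prime) (use m R_def in simp)
  have noeth: "noetherian_ring L" using noetherian_fraction_ring N unfolding R_def by blast
  have "maximalideal max_ideal L" by (simp add: maximalideal_iff)
  hence "depth L max_ideal \<le> krull_dim L"
    by (intro L.depth_le_krull_dim[OF noeth] L.maximalideal_prime)
  have no_zd: "y = \<zero>\<^bsub>R\<^esub>" if "f \<noteq> 0" "f \<otimes>\<^bsub>R\<^esub> y = \<zero>\<^bsub>R\<^esub>" for f y
    using that by (simp add: R_def poly_mult_eq_0_iff)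
  have small_dim: "krull_dim L \<le> depth L max_ideal"
    if "n \<in> S" "\<And>N c. (\<Sum>k<N. single 0 (c k) * single n 1 ^ k) \<in> m \<Longrightarrow> \<forall>k<N. c k = (0 :: 'k)" for n
  proof (cases "m = {0}")
    case True
    have "krull_dim L \<le> enat 0"
    proof (rule krull_dim_le)
      fix Q assume Q: "\<And>i. i \<le> Suc 0 \<Longrightarrow> primeideal (Q i) L" "\<And>i. i < Suc 0 \<Longrightarrow> Q i \<subset> Q (Suc i)"
      have "contraction (Q 0) \<subset> contraction (Q 1)" using contraction_psubset[OF Q(1) Q(1) Q(2)] by simp
      moreover have "contraction (Q 1) \<subseteq> {0}" using contraction_subset_prime[OF Q(1)[of 1]] True by simp
      moreover have "\<zero>\<^bsub>R\<^esub> \<in> contraction (Q 0)"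
        using additive_subgroup.zero_closed[OF ideal.axioms(1)[OF ideal_contraction[OF primeideal.axioms(1)[OF Q(1)[of 0]]]]]
        by simp
      ultimately show False by (auto simp: R_def)
    qed
    also have "enat 0 \<le> depth L max_ideal" by (simp add: zero_enat_def[symmetric])
    finally show ?thesis .
  next
    case False
    have "0 \<in> m" using additive_subgroup.zero_closed[OF additive_subgroup_axioms] by (simp add: R_def)
    then obtain f where f: "f \<in> m" "f \<noteq> 0" using False by blast
    have "krull_dim L \<le> enat 1"
    proof (rule krull_dim_le)
      fix Q assume Q: "\<And>i. i \<le> Suc 1 \<Longrightarrow> primeideal (Q i) L" "\<And>i. i < Suc 1 \<Longrightarrow> Q i \<subset> Q (Suc i)"
      have c: "primeideal (contraction (Q i)) (semigroup_ring S)" if "i \<le> 2" for i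
        using primeideal_contraction[OF Q(1)[of i]] that by (simp add: R_def)
      have sub: "contraction (Q 0) \<subset> contraction (Q 1)" "contraction (Q 1) \<subset> contraction (Q 2)"
        using contraction_psubset[OF Q(1) Q(1) Q(2), of 0] contraction_psubset[OF Q(1) Q(1) Q(2), of 1]
        by (simp_all add: numeral_2_eq_2)
      have "contraction (Q 2) \<subseteq> m" using contraction_subset_prime[OF Q(1)[of 2]] by simp
      thus False
        using no_transcendental_over_prime_chain[OF S c c c sub, of "single n 1"] that by auto
    qed
    also have "enat 1 \<le> depth L max_ideal"
      by (rule one_le_depth[OF f(1)]) (rule no_zd[OF f(2)])
    finally show ?thesis .
  qed
  have "krull_dim L \<le> depth L max_ideal"
  proof (cases "(\<forall>N c. (\<Sum>k<N. single 0 (c k) * single n1 1 ^ k) \<in> m \<longrightarrow> (\<forall>k<N. c k = (0 :: 'k))) \<or>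
     (\<forall>N c. (\<Sum>k<N. single 0 (c k) * single n2 1 ^ k) \<in> m \<longrightarrow> (\<forall>k<N. c k = (0 :: 'k)))")
    case True
    thus ?thesis using small_dim[OF n1_mem] small_dim[OF n2_mem] by blast
  next
    case False
    obtain f where f: "f \<in> m" "f \<noteq> 0" "keys f \<subseteq> range (\<lambda>k. nmul k n1)"
      using ex_axis_polynomial[OF n1_nz, of m] False by blast
    obtain g where g: "g \<in> m" "g \<noteq> 0" "keys g \<subseteq> range (\<lambda>k. nmul k n2)"
      using ex_axis_polynomial[OF n2_nz, of m] False by blast
    have "krull_dim L \<le> enat 2"
    proof (rule krull_dim_le)
      fix Q assume Q: "\<And>i. i \<le> Suc 2 \<Longrightarrow> primeideal (Q i) L" "\<And>i. i < Suc 2 \<Longrightarrow> Q i \<subset> Q (Suc i)"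
      have c: "primeideal (contraction (Q i)) (semigroup_ring S)" if "i \<le> 3" for i
        using primeideal_contraction[OF Q(1)[of i]] that by (simp add: R_def)
      have sub: "contraction (Q 0) \<subset> contraction (Q 1)" "contraction (Q 1) \<subset> contraction (Q 2)"
        "contraction (Q 2) \<subset> contraction (Q 3)"
        using contraction_psubset[OF Q(1) Q(1) Q(2), of 0] contraction_psubset[OF Q(1) Q(1) Q(2), of 1]
          contraction_psubset[OF Q(1) Q(1) Q(2), of 2]
        by (simp_all add: numeral_2_eq_2 numeral_3_eq_3)
      then obtain z where z: "z \<in> contraction (Q 3)" "z \<notin> contraction (Q 2)" by blast
      have "contraction (Q 2) \<subseteq> contraction (Q 3)" using sub(3) by blast
      note indep = transcendental_outside_prime[OF S c c this z]
      have "z \<in> carrier R" using z(1) by (simp add: contraction_def)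
      hence "z \<in> carrier (semigroup_ring S)" unfolding R_def .
      from no_transcendental_over_prime_chain[OF S c c c sub(1,2) this indep] show False by simp
    qed
    also have "enat 2 \<le> depth L max_ideal"
    proof (rule two_le_depth[OF f(1) no_zd[OF f(2)] g(1)])
      fix y q assume "y \<in> carrier R" "q \<in> carrier R" "g \<otimes>\<^bsub>R\<^esub> y = f \<otimes>\<^bsub>R\<^esub> q"
      thus "\<exists>h\<in>carrier R. y = f \<otimes>\<^bsub>R\<^esub> h"
        using axis_polynomials_regular[OF f(2,3) g(2,3), of y q] by (auto simp: R_def)
    qed
    finally show ?thesis .
  qed
  with \<open>depth L max_ideal \<le> krull_dim L\<close> have "depth L max_ideal = krull_dim L" by (rule antisym)
  hence "cohen_macaulay_local L"
    unfolding cohen_macaulay_local_def using cring_fraction_ring noeth by (auto simp: maximalideal_iff)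
  thus ?thesis unfolding localization_def R_def .
qed

end

section \<open>Semigroups generated by triangles\<close>

abbreviation real_point :: "nat \<times> nat \<Rightarrow> real \<times> real" where
  "real_point s \<equiv> (real (fst s), real (snd s))"

text \<open>
  Dilating by \<open>i\<close> changes the coefficient sum of a convex combination from \<open>1\<close> to \<open>i\<close>.  For \<open>i = 0\<close> both sides
  describe the origin.
\<close>
lemma mem_scaled_triangle_iff:
  fixes A B C X :: "real \<times> real"
  shows "X \<in> (\<lambda>X. real i *\<^sub>R X) ` (convex hull {A, B, C}) \<longleftrightarrow>
    (\<exists>a b c. 0 \<le> a \<and> 0 \<le> b \<and> 0 \<le> c \<and> a + b + c = real i \<and> X = a *\<^sub>R A + b *\<^sub>R B + c *\<^sub>R C)"
    (is "?L \<longleftrightarrow> ?R")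
proof
  assume ?L
  then obtain a b c where "0 \<le> a" "0 \<le> b" "0 \<le> c" "a + b + c = 1"
    "X = real i *\<^sub>R (a *\<^sub>R A + b *\<^sub>R B + c *\<^sub>R C)"
    by (auto simp: convex_hull_3)
  moreover from this have "real i * a + real i * b + real i * c = real i"
    by (metis distrib_left mult.right_neutral)
  ultimately show ?R
    by (intro exI[of _ "real i * a"] exI[of _ "real i * b"] exI[of _ "real i * c"])
      (simp add: scaleR_add_right)
next
  assume ?R
  then obtain a b c where abc: "0 \<le> a" "0 \<le> b" "0 \<le> c" "a + b + c = real i"
    "X = a *\<^sub>R A + b *\<^sub>R B + c *\<^sub>R C" by blast
  show ?L
  proof (cases "i = 0")
    case True
    hence "X = 0" using abc by (simp add: add_nonneg_eq_0_iff)
    thus ?thesis using True by (intro image_eqI[of _ _ A]) (auto intro: hull_inc)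
  next
    case False
    have "a / real i + b / real i + c / real i = 1"
      using abc(4) False by (simp flip: add_divide_distrib)
    hence "(a / real i) *\<^sub>R A + (b / real i) *\<^sub>R B + (c / real i) *\<^sub>R C \<in> convex hull {A, B, C}"
      using abc(1-3) unfolding convex_hull_3 by (intro CollectI exI conjI refl) auto
    moreover have "X = real i *\<^sub>R ((a / real i) *\<^sub>R A + (b / real i) *\<^sub>R B + (c / real i) *\<^sub>R C)"
      using False abc(5) by (simp add: scaleR_add_right)
    ultimately show ?thesis by blast
  qed
qed

lemma mem_body_semigroup_iff:
  "s \<in> body_semigroup (convex hull {A, B, C}) \<longleftrightarrow>
    (\<exists>(i::nat) a b c. 0 \<le> a \<and> 0 \<le> b \<and> 0 \<le> c \<and> a + b + c = real i \<and>
       real_point s = a *\<^sub>R A + b *\<^sub>R B + c *\<^sub>R C)"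
  unfolding body_semigroup_def
  by (cases s) (simp add: mem_scaled_triangle_iff)

definition cross :: "real \<times> real \<Rightarrow> real \<times> real \<Rightarrow> real" where
  "cross X Y = fst X * snd Y - snd X * fst Y"

lemma cross_simps:
  "cross (X + Y) Z = cross X Z + cross Y Z" "cross (a *\<^sub>R X) Z = a * cross X Z"
  "cross X X = 0" "cross X Y = - cross Y X"
  by (simp_all add: cross_def algebra_simps)

lemma coordinates_unique:
  assumes "cross A B \<noteq> 0" "a *\<^sub>R A + b *\<^sub>R B = a' *\<^sub>R A + b' *\<^sub>R B"
  shows "a = a'" "b = b'"
proof -
  have "cross (a *\<^sub>R A + b *\<^sub>R B) B = cross (a' *\<^sub>R A + b' *\<^sub>R B) B"
    "cross (a *\<^sub>R A + b *\<^sub>R B) A = cross (a' *\<^sub>R A + b' *\<^sub>R B) A"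
    using assms(2) by simp_all
  thus "a = a'" "b = b'" using assms(1) cross_simps(4)[of A B] by (auto simp: cross_simps(1-3))
qed

text \<open>
  The position of a triangle relative to the cone it spans: \<open>A\<close> and \<open>B\<close> lie on the extremal rays, and \<open>C\<close> may
  be on either side of the line through \<open>A\<close> and \<open>B\<close>, or even be the origin.
\<close>
locale triangle_cone =
  fixes A B C :: "real \<times> real" and \<gamma> \<delta> :: real and k :: nat and n1 n2 :: "nat \<times> nat"
  assumes pos: "convex hull {A, B, C} \<subseteq> {0..} \<times> {0..}"
    and indep: "cross A B \<noteq> 0"
    and C: "C = \<gamma> *\<^sub>R A + \<delta> *\<^sub>R B" "0 \<le> \<gamma>" "0 \<le> \<delta>"
    and n1: "real_point n1 = real k *\<^sub>R A" and n2: "real_point n2 = real k *\<^sub>R B"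
begin

abbreviation "S \<equiv> body_semigroup (convex hull {A, B, C})"

text \<open>
  Subtracting \<open>k A\<close> from \<open>u\<close> leaves the coefficients of \<open>B\<close> and \<open>C\<close> alone, so only that of \<open>A\<close> could become
  negative.  The points \<open>u - k A\<close> and \<open>v - k B\<close> are equal, so \<open>u - k A\<close> has the same \<open>A\<close>-coordinate as \<open>v\<close>, namely
  \<open>a2 + c2 \<gamma>\<close>.  Since \<open>C\<close> contributes \<open>c1 \<gamma> \<le> c2 \<gamma>\<close> to it in the first representation, at least \<open>a2 \<ge> 0\<close> is
  left for \<open>A\<close>.
\<close>
lemma gap_if_le:
  assumes uv: "u + n2 = v + n1"
    and 1: "0 \<le> a1" "0 \<le> b1" "0 \<le> c1" "a1 + b1 + c1 = real i"
      "real_point u = a1 *\<^sub>R A + b1 *\<^sub>R B + c1 *\<^sub>R C"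
    and 2: "0 \<le> a2" "real_point v = a2 *\<^sub>R A + b2 *\<^sub>R B + c2 *\<^sub>R C"
    and le: "c1 \<le> c2"
  shows "\<exists>t\<in>S. u = t + n1"
proof -
  have "real_point u + real_point n2 = real_point v + real_point n1"
    using arg_cong[OF uv, of real_point] by (simp add: plus_prod_def)
  hence "(a1 + c1 * \<gamma>) *\<^sub>R A + (b1 + c1 * \<delta> + k) *\<^sub>R B = (a2 + c2 * \<gamma> + k) *\<^sub>R A + (b2 + c2 * \<delta>) *\<^sub>R B"
    unfolding 1(5) 2(2) n1 n2 C(1) by (simp add: algebra_simps)
  from coordinates_unique(1)[OF indep this] have "a1 - k = a2 + (c2 - c1) * \<gamma>"
    by (simp add: algebra_simps)
  hence a: "0 \<le> a1 - k" using 2(1) le C(2) by simp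
  define j where "j = i - k"
  have j: "(a1 - k) + b1 + c1 = real j" using a 1(2,3,4) by (simp add: j_def of_nat_diff)
  have u: "real_point u - real k *\<^sub>R A = (a1 - k) *\<^sub>R A + b1 *\<^sub>R B + c1 *\<^sub>R C"
    unfolding 1(5) by (simp add: algebra_simps)
  hence "real_point u - real k *\<^sub>R A \<in> (\<lambda>X. real j *\<^sub>R X) ` (convex hull {A, B, C})"
    unfolding mem_scaled_triangle_iff using a 1(2,3) j by blast
  then obtain X where "X \<in> convex hull {A, B, C}" "real_point u - real k *\<^sub>R A = real j *\<^sub>R X" by blast
  hence "real_point u - real_point n1 \<in> {0..} \<times> {0..}" using pos n1 by (force simp: mem_Times_iff)
  hence le: "fst n1 \<le> fst u" "snd n1 \<le> snd u" by auto
  define t where "t = (fst u - fst n1, snd u - snd n1)"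
  have t: "u = t + n1" using le by (auto simp: t_def prod_eq_iff)
  have "real_point t = real_point u - real_point n1" using le by (simp add: t_def of_nat_diff)
  hence "real_point t = (a1 - k) *\<^sub>R A + b1 *\<^sub>R B + c1 *\<^sub>R C" using u n1 by simp
  hence "t \<in> S" unfolding mem_body_semigroup_iff using a 1(2,3) j by blast
  thus ?thesis using t by blast
qed

end

lemma triangle_cone_swap:
  assumes "triangle_cone A B C \<gamma> \<delta> k n1 n2"
  shows "triangle_cone B A C \<delta> \<gamma> k n2 n1"
proof -
  interpret triangle_cone A B C \<gamma> \<delta> k n1 n2 by fact
  show ?thesis
    using pos indep C n1 n2 cross_simps(4)[of A B]
    by unfold_locales (auto simp: insert_commute add.commute)
qed

context triangle_cone
begin

text \<open>
  Exchanging the roles of \<open>A\<close> and \<open>B\<close> reduces to the case where the representation of \<open>u\<close> uses at most as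
  much of \<open>C\<close> as that of \<open>v\<close>.
\<close>
lemma gap:
  assumes u: "u \<in> S" and v: "v \<in> S" and uv: "u + n2 = v + n1"
  shows "\<exists>t\<in>S. u = t + n1"
proof -
  obtain i a1 b1 c1 where 1: "0 \<le> a1" "0 \<le> b1" "0 \<le> c1" "a1 + b1 + c1 = real i"
      "real_point u = a1 *\<^sub>R A + b1 *\<^sub>R B + c1 *\<^sub>R C"
    using u unfolding mem_body_semigroup_iff by blast
  obtain j a2 b2 c2 where 2: "0 \<le> a2" "0 \<le> b2" "0 \<le> c2" "a2 + b2 + c2 = real j"
      "real_point v = a2 *\<^sub>R A + b2 *\<^sub>R B + c2 *\<^sub>R C"
    using v unfolding mem_body_semigroup_iff by blast
  show ?thesis
  proof (cases "c1 \<le> c2")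
    case True
    show ?thesis by (rule gap_if_le[OF uv 1 2(1,5) True])
  next
    case False
    interpret swap: triangle_cone B A C \<delta> \<gamma> k n2 n1
      by (rule triangle_cone_swap) unfold_locales
    have "\<exists>t\<in>body_semigroup (convex hull {B, A, C}). v = t + n2"
      by (rule swap.gap_if_le[OF uv[symmetric], of b2 a2 c2 j b1 a1 c1])
        (use 1 2 False in \<open>simp_all add: add_ac\<close>)
    then obtain t where t: "t \<in> S" "v = t + n2" by (auto simp: insert_commute)
    have "u + n2 = (t + n1) + n2" using uv t(2) by (simp add: add_ac)
    hence "u = t + n1" by (rule add_right_imp_eq)
    thus ?thesis using t(1) by blast
  qed
qed

lemma n1_mem: "n1 \<in> S"
  unfolding mem_body_semigroup_iff
  by (intro exI[of _ k] exI[of _ "real k"] exI[of _ 0]) (use n1 in auto)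

lemma n2_mem: "n2 \<in> S"
  unfolding mem_body_semigroup_iff
  by (rule exI[of _ k], rule exI[of _ 0], rule exI[of _ "real k"], rule exI[of _ 0]) (use n2 in auto)

end

lemma collinear_if_cross_eq_0:
  assumes "X \<noteq> 0" "cross X Y = 0" "cross X Z = 0"
  shows "collinear {X, Y, Z}"
proof -
  have "\<exists>c. W = c *\<^sub>R X" if "cross X W = 0" for W
  proof (cases "fst X = 0")
    case True
    hence "snd X \<noteq> 0" "fst W = 0" using that assms(1) by (auto simp: cross_def prod_eq_iff)
    thus ?thesis using True by (intro exI[of _ "snd W / snd X"]) (simp add: prod_eq_iff)
  next
    case False
    thus ?thesis using that
      by (intro exI[of _ "fst W / fst X"]) (simp add: prod_eq_iff cross_def field_simps)
  qed
  then obtain c d where "Y = c *\<^sub>R X" "Z = d *\<^sub>R X" using assms(2,3) by blast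
  hence "\<forall>V\<in>{X, Y, Z}. \<exists>c. V = c *\<^sub>R X" by (metis empty_iff insert_iff scaleR_one)
  thus ?thesis unfolding collinear_def by (metis scaleR_left_diff_distrib)
qed

text \<open>
  With \<open>p = cross A B\<close>, \<open>q = cross B C\<close> and \<open>r = cross C A\<close> one has \<open>q A + r B + p C = 0\<close>.  As the vertices have
  nonnegative coordinates, two of these numbers cannot have the same strict sign unless the third one has
  the opposite sign.  So one of them, say \<open>p\<close>, is nonzero and has no other one on its side of zero; solving
  for \<open>C\<close> then gives nonnegative coefficients.
\<close>
lemma ex_vertex_in_cone:
  assumes nc: "\<not> collinear {A, B, C :: real \<times> real}" and pos: "{A, B, C} \<subseteq> {0..} \<times> {0..}"
  shows "\<exists>A' B' C' \<gamma> \<delta>. {A', B', C'} = {A, B, C} \<and> cross A' B' \<noteq> 0 \<and>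
    C' = \<gamma> *\<^sub>R A' + \<delta> *\<^sub>R B' \<and> 0 \<le> \<gamma> \<and> 0 \<le> \<delta>" (is ?thesis)
proof -
  have key: ?thesis if "{X, Y, Z} = {A, B, C}" and
    s: "cross X Y > 0 \<and> cross Y Z \<le> 0 \<and> cross Z X \<le> 0 \<or> cross X Y < 0 \<and> cross Y Z \<ge> 0 \<and> cross Z X \<ge> 0"
    for X Y Z
  proof (intro exI conjI)
    show "{X, Y, Z} = {A, B, C}" by fact
    show nz: "cross X Y \<noteq> 0" using s by auto
    show "0 \<le> - cross Y Z / cross X Y" "0 \<le> - cross Z X / cross X Y"
      using s by (auto simp: divide_le_0_iff)
    have "cross X Y *\<^sub>R Z = - cross Y Z *\<^sub>R X + - cross Z X *\<^sub>R Y"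
      by (simp add: prod_eq_iff cross_def algebra_simps)
    thus "Z = (- cross Y Z / cross X Y) *\<^sub>R X + (- cross Z X / cross X Y) *\<^sub>R Y"
      using nz by (simp add: prod_eq_iff field_simps)
  qed
  have two: "\<not> (cross Y Z > 0 \<and> cross Z X > 0 \<and> cross X Y \<ge> 0)"
    "\<not> (cross Y Z < 0 \<and> cross Z X < 0 \<and> cross X Y \<le> 0)"
    if "X \<in> {A, B, C}" "Y \<in> {A, B, C}" "Z \<in> {A, B, C}" for X Y Z
  proof -
    have ge: "fst W \<ge> 0" "snd W \<ge> 0" if "W \<in> {A, B, C}" for W
      using that pos by (auto simp: mem_Times_iff)
    have rel: "cross Y Z * fst X + cross Z X * fst Y + cross X Y * fst Z = 0"
      "cross Y Z * snd X + cross Z X * snd Y + cross X Y * snd Z = 0"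
      by (simp_all add: cross_def algebra_simps)
    have zero: "x = 0" if "p * x + q * y + r * z = 0" "x \<ge> 0" "y \<ge> 0" "z \<ge> 0"
      "p > 0 \<and> q > 0 \<and> r \<ge> 0 \<or> p < 0 \<and> q < 0 \<and> r \<le> 0" for p q r x y z :: real
    proof -
      have "p * x = 0"
        using that(5)
      proof
        assume "p > 0 \<and> q > 0 \<and> r \<ge> 0"
        hence "p * x \<ge> 0" "q * y \<ge> 0" "r * z \<ge> 0" using that by auto
        thus ?thesis using that(1) by linarith
      next
        assume "p < 0 \<and> q < 0 \<and> r \<le> 0"
        hence "p * x \<le> 0" "q * y \<le> 0" "r * z \<le> 0" using that by (auto simp: mult_le_0_iff)
        thus ?thesis using that(1) by linarith
      qed
      thus ?thesis using that(5) by auto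
    qed
    have False if "cross Y Z > 0 \<and> cross Z X > 0 \<and> cross X Y \<ge> 0 \<or> cross Y Z < 0 \<and> cross Z X < 0 \<and> cross X Y \<le> 0"
    proof -
      have "fst X = 0" "snd X = 0"
        using zero[OF rel(1) _ _ _ that] zero[OF rel(2) _ _ _ that] ge \<open>X \<in> _\<close> \<open>Y \<in> _\<close> \<open>Z \<in> _\<close> by auto
      hence "cross Z X = 0" by (simp add: cross_def)
      thus False using that by simp
    qed
    thus "\<not> (cross Y Z > 0 \<and> cross Z X > 0 \<and> cross X Y \<ge> 0)"
      "\<not> (cross Y Z < 0 \<and> cross Z X < 0 \<and> cross X Y \<le> 0)" by blast+
  qed
  have nz: "cross A B \<noteq> 0 \<or> cross B C \<noteq> 0 \<or> cross C A \<noteq> 0"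
  proof (rule ccontr)
    assume "\<not> ?thesis"
    hence z: "cross A B = 0" "cross B C = 0" "cross C A = 0" "cross A C = 0" "cross B A = 0" "cross C B = 0"
      using cross_simps(4)[of A C] cross_simps(4)[of B A] cross_simps(4)[of C B] by auto
    have "A \<noteq> 0 \<or> B \<noteq> 0" using nc by auto
    thus False
      using collinear_if_cross_eq_0[of A B C] collinear_if_cross_eq_0[of B A C] z nc
      by (auto simp: insert_commute)
  qed
  have perm: "{B, C, A} = {A, B, C}" "{C, A, B} = {A, B, C}" by auto
  consider "cross A B > 0 \<and> cross B C \<le> 0 \<and> cross C A \<le> 0 \<or> cross A B < 0 \<and> cross B C \<ge> 0 \<and> cross C A \<ge> 0"
    | "cross B C > 0 \<and> cross C A \<le> 0 \<and> cross A B \<le> 0 \<or> cross B C < 0 \<and> cross C A \<ge> 0 \<and> cross A B \<ge> 0"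
    | "cross C A > 0 \<and> cross A B \<le> 0 \<and> cross B C \<le> 0 \<or> cross C A < 0 \<and> cross A B \<ge> 0 \<and> cross B C \<ge> 0"
    using nz two[of A B C] two[of B C A] two[of C A B] by simp argo
  thus ?thesis by cases (rule key[OF refl], assumption, rule key[OF perm(1)], assumption, rule key[OF perm(2)], assumption)
qed

lemma common_denominator:
  assumes "A \<in> \<rat> \<times> \<rat>" "B \<in> \<rat> \<times> \<rat>" "A \<in> {0..} \<times> {0..}" "B \<in> {0..} \<times> {0..}"
  obtains k :: nat and n1 n2 :: "nat \<times> nat" where "k > 0"
    "real_point n1 = real k *\<^sub>R A" "real_point n2 = real k *\<^sub>R B"
proof -
  have "\<exists>d m :: nat. d > 0 \<and> real d * x = real m" if "x \<in> \<rat>" "x \<ge> 0" for x :: real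
  proof -
    obtain m d :: nat where "d \<noteq> 0" "\<bar>x\<bar> = real m / real d" using Rats_abs_nat_div_natE[OF \<open>x \<in> \<rat>\<close>] by blast
    thus ?thesis using that(2) by (intro exI[of _ d] exI[of _ m]) auto
  qed note den = this
  obtain d1 m1 where 1: "d1 > 0" "real d1 * fst A = real m1" using den[of "fst A"] assms by (auto simp: mem_Times_iff)
  obtain d2 m2 where 2: "d2 > 0" "real d2 * snd A = real m2" using den[of "snd A"] assms by (auto simp: mem_Times_iff)
  obtain d3 m3 where 3: "d3 > 0" "real d3 * fst B = real m3" using den[of "fst B"] assms by (auto simp: mem_Times_iff)
  obtain d4 m4 where 4: "d4 > 0" "real d4 * snd B = real m4" using den[of "snd B"] assms by (auto simp: mem_Times_iff)
  define k where "k = d1 * d2 * d3 * d4"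
  have "real k * fst A = real (d2 * d3 * d4) * (real d1 * fst A)"
    "real k * snd A = real (d1 * d3 * d4) * (real d2 * snd A)"
    "real k * fst B = real (d1 * d2 * d4) * (real d3 * fst B)"
    "real k * snd B = real (d1 * d2 * d3) * (real d4 * snd B)"
    by (simp_all add: k_def)
  hence "real k * fst A = real (d2 * d3 * d4 * m1)" "real k * snd A = real (d1 * d3 * d4 * m2)"
    "real k * fst B = real (d1 * d2 * d4 * m3)" "real k * snd B = real (d1 * d2 * d3 * m4)"
    unfolding 1 2 3 4 by simp_all
  moreover have "k > 0" using 1 2 3 4 by (simp add: k_def)
  ultimately show ?thesis
    by (intro that[of k "(d2 * d3 * d4 * m1, d1 * d3 * d4 * m2)" "(d1 * d2 * d4 * m3, d1 * d2 * d3 * m4)"])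
      (simp_all add: prod_eq_iff)
qed

theorem corollary12:
  fixes T :: "(real \<times> real) set"
  assumes "rational_triangle T"
    and "T \<subseteq> {0..} \<times> {0..}"
    and "affine_semigroup (body_semigroup T)"
  shows "cohen_macaulay (semigroup_ring (body_semigroup T) :: ((nat \<times> nat) \<Rightarrow>\<^sub>0 'k::field) ring)"
proof -
  obtain A0 B0 C0 where T0: "{A0, B0, C0} \<subseteq> \<rat> \<times> \<rat>" "\<not> collinear {A0, B0, C0}" "T = convex hull {A0, B0, C0}"
    using assms(1) unfolding rational_triangle_def by blast
  have "{A0, B0, C0} \<subseteq> {0..} \<times> {0..}"
    using assms(2) hull_subset[of "{A0, B0, C0}" convex] unfolding T0(3) by blast
  from ex_vertex_in_cone[OF T0(2) this] obtain A B C \<gamma> \<delta> where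
    ABC: "{A, B, C} = {A0, B0, C0}" "cross A B \<noteq> 0" "C = \<gamma> *\<^sub>R A + \<delta> *\<^sub>R B" "0 \<le> \<gamma>" "0 \<le> \<delta>" by blast
  have "{A, B, C} \<subseteq> \<rat> \<times> \<rat>" using T0(1) unfolding ABC(1) .
  moreover have "T = convex hull {A, B, C}" unfolding T0(3) ABC(1) ..
  ultimately have T: "T = convex hull {A, B, C}" "A \<in> \<rat> \<times> \<rat>" "B \<in> \<rat> \<times> \<rat>"
    by simp_all
  have "A \<in> T" "B \<in> T" unfolding T(1) by (auto intro: hull_inc)
  hence "A \<in> {0..} \<times> {0..}" "B \<in> {0..} \<times> {0..}" using assms(2) by auto
  then obtain k n1 n2 where k: "k > 0" "real_point n1 = real k *\<^sub>R A" "real_point n2 = real k *\<^sub>R B"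
    using common_denominator[OF T(2,3)] by blast
  interpret cone: triangle_cone A B C \<gamma> \<delta> k n1 n2
    using assms(2) T(1) ABC k by unfold_locales auto
  have S: "is_submonoid (body_semigroup T)" using assms(3) by (simp add: affine_semigroup_def)
  have nz: "n \<noteq> 0" if n: "real_point n = real k *\<^sub>R X" and X: "X \<noteq> 0" for n X
  proof
    assume "n = 0"
    hence "real k *\<^sub>R X = 0" using n by (simp add: prod_eq_iff)
    thus False using k(1) X by simp
  qed
  have "A \<noteq> 0" "B \<noteq> 0" using ABC(2) by (auto simp: cross_def)
  hence "n1 \<noteq> 0" "n2 \<noteq> 0" using nz k(2,3) by blast+
  then interpret axis_pair "body_semigroup T" n1 n2
    using S cone.gap cone.n1_mem cone.n2_mem unfolding T(1) by unfold_locales auto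
  obtain G where G: "finite G" "body_semigroup T = is_submonoid hull G"
    using assms(3) by (auto simp: affine_semigroup_def)
  have "noetherian_ring (semigroup_ring (body_semigroup T) :: (nat \<times> nat \<Rightarrow>\<^sub>0 'k) ring)"
    by (rule noetherian_semigroup_ring[OF S]) (unfold G(2), rule dickson_finitely_generated[OF G(1)])
  thus ?thesis
    unfolding cohen_macaulay_def using cring_semigroup_ring[OF S] localization_cohen_macaulay by blast
qed

end
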